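(* For each $n\ge1$ let $\mathbf{p}^{(n)}=(p_i^{(n)})_{i\in\mathbb{I}}$ be a probability distribution on $\mathbb{I}$ and let $G=(G_1,\dots,G_n)$ be i.i.d. with $\mathbb{P}(G_j=i)=p_i^{(n)}$. Let $R\in(0,1)$ and suppose that $p_i^{(n)}\le R$ for all $n\ge1$ and $i\in\mathbb{I}$. Let $K_n$ be the total number of cycles of $\mathrm{std}(G)$. Then, as $n\to+\infty$, $$\frac{K_n-\log(n)}{\sqrt{\log(n)}}\ \overset{(d)}{\longrightarrow}\ \mathcal{N}(0,1),$$ and the moments converge, i.e. for every integer $r\ge1$ the $r$-th moment of the left-hand side converges to the $r$-th moment of $\mathcal{N}(0,1)$.
   Context: $\mathbb{I}\subset\mathbb{R}$ is a countable set. For $g=(g_1,\dots,g_n)\in\mathbb{R}^n$, the standardized permutation $\sigma=\mathrm{std}(g)\in\mathfrak{S}_n$ is defined by: $\sigma(j)<\sigma(k)$ if and only if $g_j<g_k$, or $g_j=g_k$ and $j<k$. Fixed points count as cycles (of length 1). *)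

theory Defs
  imports
    "HOL-Probability.Probability"
    "HOL-Combinatorics.Orbits"
begin

text \<open>A vector of length \<open>n\<close> is a function on the index set \<open>{1..n}\<close>; values outside
  that set are irrelevant. Elements of the symmetric group on \<open>n\<close> letters are functions that
  permute \<open>{1..n}\<close>, hence are the identity outside it.\<close>

definition is_standardization :: "nat \<Rightarrow> (nat \<Rightarrow> real) \<Rightarrow> (nat \<Rightarrow> nat) \<Rightarrow> bool" where
  "is_standardization n g \<sigma> \<longleftrightarrow> \<sigma> permutes {1..n} \<and>
     (\<forall>j\<in>{1..n}. \<forall>k\<in>{1..n}. \<sigma> j < \<sigma> k \<longleftrightarrow> g j < g k \<or> (g j = g k \<and> j < k))"

definition standardize :: "nat \<Rightarrow> (nat \<Rightarrow> real) \<Rightarrow> nat \<Rightarrow> nat" where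
  "standardize n g = (THE \<sigma>. is_standardization n g \<sigma>)"

lemma is_standardization_ex1: "\<exists>!\<sigma>. is_standardization n g \<sigma>"
proof -
  define lt where "lt j k \<longleftrightarrow> g j < g k \<or> (g j = g k \<and> j < k)" for j k
  define f where "f j = (if j \<in> {1..n} then card {k\<in>{1..n}. \<not> lt j k} else j)" for j
  have iff: "f j < f k \<longleftrightarrow> lt j k" if jk: "j \<in> {1..n}" "k \<in> {1..n}" for j k
  proof -
    have mono: "f a < f b" if "lt a b" "a \<in> {1..n}" "b \<in> {1..n}" for a b
    proof -
      have "{k\<in>{1..n}. \<not> lt a k} \<subset> {k\<in>{1..n}. \<not> lt b k}"
        using that by (auto simp: lt_def)
      then show ?thesis using that by (auto simp: f_def intro!: psubset_card_mono)
    qed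
    have "lt j k \<or> j = k \<or> lt k j" by (auto simp: lt_def)
    then show ?thesis using mono[of j k] mono[of k j] jk by (auto simp: lt_def)
  qed
  have "f permutes {1..n}"
  proof (rule bij_imp_permutes)
    have inj: "inj_on f {1..n}"
    proof (rule inj_onI)
      fix j k assume *: "j \<in> {1..n}" "k \<in> {1..n}" "f j = f k"
      have "lt j k \<or> j = k \<or> lt k j" by (auto simp: lt_def)
      then show "j = k" using iff[of j k] iff[of k j] * by auto
    qed
    have "f j \<in> {1..n}" if j: "j \<in> {1..n}" for j
    proof -
      have "card {k\<in>{1..n}. \<not> lt j k} \<le> card {1..n}" by (intro card_mono) auto
      moreover have "j \<in> {k\<in>{1..n}. \<not> lt j k}" using j by (auto simp: lt_def)
      then have "card {k\<in>{1..n}. \<not> lt j k} > 0" by (subst card_gt_0_iff) auto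
      ultimately show ?thesis using j by (auto simp: f_def)
    qed
    then have "f ` {1..n} \<subseteq> {1..n}" by blast
    then show "bij_betw f {1..n} {1..n}"
      using inj endo_inj_surj[of "{1..n}" f] unfolding bij_betw_def by blast
  qed (auto simp: f_def)
  then have "is_standardization n g f"
    using iff by (auto simp: is_standardization_def lt_def)
  moreover have "\<sigma> = f" if \<sigma>: "is_standardization n g \<sigma>" for \<sigma>
  proof
    fix j
    have perm: "\<sigma> permutes {1..n}" using \<sigma> by (simp add: is_standardization_def)
    have lt: "\<sigma> a < \<sigma> b \<longleftrightarrow> lt a b" if "a \<in> {1..n}" "b \<in> {1..n}" for a b
      using \<sigma> that by (auto simp: is_standardization_def lt_def)
    show "\<sigma> j = f j"
    proof (cases "j \<in> {1..n}")
      case True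
      then have *: "\<sigma> j \<in> {1..n}" using permutes_in_image[OF perm] by blast
      have "\<sigma> ` {k\<in>{1..n}. \<not> lt j k} = {1..\<sigma> j}"
      proof (intro equalityI subsetI)
        fix m assume "m \<in> \<sigma> ` {k\<in>{1..n}. \<not> lt j k}"
        then obtain k where k: "k \<in> {1..n}" "\<not> lt j k" "m = \<sigma> k" by blast
        then have "\<sigma> k \<in> {1..n}" using permutes_in_image[OF perm] by blast
        then show "m \<in> {1..\<sigma> j}" using k lt[OF True k(1)] by auto
      next
        fix m assume m: "m \<in> {1..\<sigma> j}"
        then have "m \<in> {1..n}" using * by auto
        then have "m \<in> \<sigma> ` {1..n}" unfolding permutes_image[OF perm] .
        then obtain k where k: "k \<in> {1..n}" "m = \<sigma> k" by blast
        then show "m \<in> \<sigma> ` {k\<in>{1..n}. \<not> lt j k}" using m lt[OF True k(1)] by auto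
      qed
      moreover have "card (\<sigma> ` {k\<in>{1..n}. \<not> lt j k}) = card {k\<in>{1..n}. \<not> lt j k}"
        by (intro card_image permutes_inj_on[OF perm])
      ultimately show ?thesis using True by (simp add: f_def)
    next
      case False
      then show ?thesis using permutes_not_in[OF perm False] unfolding f_def by presburger
    qed
  qed
  ultimately show ?thesis by blast
qed

lemma is_standardization_standardize: "is_standardization n g (standardize n g)"
  unfolding standardize_def by (rule theI'[OF is_standardization_ex1])

text \<open>The cycles of a permutation of \<open>{1..n}\<close> correspond to its orbits on \<open>{1..n}\<close>;
  a fixed point \<open>j\<close> contributes the orbit \<open>{j}\<close>.\<close>

definition num_cycles :: "nat \<Rightarrow> (nat \<Rightarrow> nat) \<Rightarrow> nat" where
  "num_cycles n \<sigma> = card {C. C \<subseteq> {1..n} \<and> cyclic_on \<sigma> C}"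

end

theory Submission
  imports Defs "HOL-Combinatorics.Cycles" "HOL-Library.Fun_Lexorder"
    "HOL-Complex_Analysis.Complex_Analysis" "HOL-Real_Asymp.Real_Asymp"
begin

text \<open>Send a word \<open>g\<close> to the multiset of the backward words
  \<open>g (\<sigma>\<^sup>-\<^sup>1 i), g (\<sigma>\<^sup>-\<^sup>2 i), \<dots>\<close> with \<open>\<sigma> = std g\<close>
  (the Gessel--Reutenauer correspondence). This map is injective, since positions are sorted by their
  backward words; its values are shift-invariant multisets, i.e. multisets of primitive necklaces; and
  the cycles of \<open>\<sigma>\<close> become the necklaces. Removing from such a multiset several copies of the necklace
  through a marked letter gives, for \<open>f n = E (exp (z * K))\<close>, the recursion
  \<open>n * f n = (\<Sum>k=1..n. q k * f (n - k))\<close>, where \<open>q k = E (exp (m * z))\<close> and \<open>m\<close> is the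
  exponent of a random word of length \<open>k\<close>. At \<open>z = 0\<close> it shows that both sides of the injection have
  total mass 1, so surjectivity comes for free. As \<open>p \<le> R < 1\<close>, a random word is primitive up to an
  exponentially small probability, so \<open>q k\<close> is close to \<open>exp z\<close>; for \<open>q k = exp z\<close> the recursion
  describes the cycles of a uniform permutation, with the explicit solution
  \<open>\<Prod>k=1..n. 1 + (exp z - 1) / k\<close>. Hence the moment generating function of the normalized cycle count
  tends to \<open>exp (s\<^sup>2 / 2)\<close> locally uniformly in the complex plane, which yields both
  claims by Levy's theorem and by convergence of derivatives at 0.\<close>

subsection \<open>Multisets invariant under a map\<close>

text \<open>The assumption on \<open>k\<close> says that \<open>x\<close> is periodic, so that
  \<open>least_power f x\<close> is a genuine minimal period and not a \<open>LEAST\<close> over an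
  empty set; the fixing exponents are then exactly its multiples.\<close>

lemma funpow_fixed_iff_least_power_dvd:
  assumes "0 < k" "(f ^^ k) x = x"
  shows "(f ^^ m) x = x \<longleftrightarrow> least_power f x dvd m"
proof
  show "(f ^^ m) x = x \<Longrightarrow> least_power f x dvd m"
    by (rule least_power_minimal)
  assume "least_power f x dvd m"
  then have "(f ^^ (m mod least_power f x)) x = x" by simp
  then show "(f ^^ m) x = x"
    using least_powerI(1)[of k f x] assms funpow_mod_eq[of _ f x m] by auto
qed

text \<open>From \<open>(f ^^ t) x\<close> another \<open>k * t - t\<close> steps lead back to
  \<open>x\<close>, because \<open>k * t\<close> is a multiple of a period. Hence both points are
  fixed by the same powers of \<open>f\<close>.\<close>

lemma least_power_funpow:
  assumes "0 < k" "(f ^^ k) x = x"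
  shows "least_power f ((f ^^ t) x) = least_power f x"
proof -
  have iff: "(f ^^ m) ((f ^^ t) x) = (f ^^ t) x \<longleftrightarrow> (f ^^ m) x = x" for m
  proof
    assume "(f ^^ m) x = x"
    then show "(f ^^ m) ((f ^^ t) x) = (f ^^ t) x"
      by (metis add.commute comp_apply funpow_add)
  next
    assume *: "(f ^^ m) ((f ^^ t) x) = (f ^^ t) x"
    have kt: "(f ^^ (k * t)) x = x"
      using funpow_fixed_iff_least_power_dvd[OF assms] assms by simp
    have "t \<le> k * t" using assms(1) by simp
    then have fback: "(f ^^ (k * t - t)) ((f ^^ t) x) = x"
      using kt by (metis comp_apply funpow_add le_add_diff_inverse2)
    have "(f ^^ m) x = (f ^^ m) ((f ^^ (k * t - t)) ((f ^^ t) x))" using fback by simp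
    also have "\<dots> = (f ^^ (k * t - t)) ((f ^^ m) ((f ^^ t) x))"
      by (metis add.commute comp_apply funpow_add)
    also have "\<dots> = x" using * fback by simp
    finally show "(f ^^ m) x = x" .
  qed
  show ?thesis unfolding least_power_def iff ..
qed

text \<open>A multiset rather than a set, so that several copies of an orbit can be added to and
  removed from an invariant multiset. For periodic \<open>x\<close> every orbit point occurs exactly
  once.\<close>

definition orbit_mset :: "('b \<Rightarrow> 'b) \<Rightarrow> 'b \<Rightarrow> 'b multiset" where
  "orbit_mset f x = image_mset (\<lambda>t. (f ^^ t) x) (mset_set {..<least_power f x})"

lemma size_orbit_mset [simp]: "size (orbit_mset f x) = least_power f x"
  by (simp add: orbit_mset_def)

lemma set_orbit_mset: "set_mset (orbit_mset f x) = (\<lambda>t. (f ^^ t) x) ` {..<least_power f x}"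
  by (simp add: orbit_mset_def)

text \<open>A coincidence at exponents \<open>i < j\<close> below the minimal period
  \<open>l\<close>, pushed forward by \<open>l - j\<close> steps, would give the smaller period
  \<open>l - j + i\<close>.\<close>

lemma inj_on_funpow_least_power:
  assumes "0 < k" "(f ^^ k) x = x"
  shows "inj_on (\<lambda>t. (f ^^ t) x) {..<least_power f x}"
proof (rule linorder_inj_onI)
  fix i j assume ij: "i < j" "i \<in> {..<least_power f x}" "j \<in> {..<least_power f x}"
  show "(f ^^ i) x \<noteq> (f ^^ j) x"
  proof
    assume eq: "(f ^^ i) x = (f ^^ j) x"
    let ?l = "least_power f x"
    have "(f ^^ (?l - j + i)) x = (f ^^ (?l - j + j)) x"
      using eq by (simp add: funpow_add)
    also have "\<dots> = x" using ij least_powerI(1)[of k f x] assms by simp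
    finally have "?l \<le> ?l - j + i"
      using ij by (intro least_power_le) auto
    then show False using ij by auto
  qed
qed auto

lemma count_orbit_mset_le:
  assumes "0 < k" "(f ^^ k) x = x"
  shows "count (orbit_mset f x) y \<le> 1"
proof -
  have "orbit_mset f x = mset_set ((\<lambda>t. (f ^^ t) x) ` {..<least_power f x})"
    unfolding orbit_mset_def by (rule image_mset_mset_set[OF inj_on_funpow_least_power[OF assms]])
  then show ?thesis by (simp add: count_mset_set')
qed

lemma self_in_orbit_mset:
  assumes "0 < k" "(f ^^ k) x = x"
  shows "x \<in># orbit_mset f x"
  using least_powerI(2)[of k f x] assms by (auto simp: set_orbit_mset intro!: image_eqI[of _ _ 0])

text \<open>Applying \<open>f\<close> moves the exponents \<open>0..l-1\<close> to
  \<open>1..l\<close>, and periodicity identifies exponent \<open>l\<close> with exponent 0.\<close>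

lemma image_orbit_mset:
  assumes "0 < k" "(f ^^ k) x = x"
  shows "image_mset f (orbit_mset f x) = orbit_mset f x"
proof -
  obtain l where l: "least_power f x = Suc l"
    using least_powerI(2)[of k f x] assms by (cases "least_power f x") auto
  have per: "(f ^^ Suc l) x = x" using least_powerI(1)[of k f x] assms l by simp
  have "image_mset f (orbit_mset f x) = image_mset (\<lambda>t. (f ^^ t) x) (image_mset Suc (mset_set {..<Suc l}))"
    by (simp add: orbit_mset_def l image_mset.compositionality comp_def)
  also have "image_mset Suc (mset_set {..<Suc l}) = add_mset (Suc l) (image_mset Suc (mset_set {..<l}))"
    by (simp add: lessThan_Suc)
  also have "image_mset Suc (mset_set {..<l}) = mset_set {1..<Suc l}"
    by (simp add: image_mset_mset_set lessThan_atLeast0)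
  also have "image_mset (\<lambda>t. (f ^^ t) x) (add_mset (Suc l) (mset_set {1..<Suc l}))
      = image_mset (\<lambda>t. (f ^^ t) x) (add_mset 0 (mset_set {1..<Suc l}))"
    using per by simp
  also have "add_mset 0 (mset_set {1..<Suc l}) = mset_set {..<Suc l}"
  proof -
    have "{..<Suc l} = insert 0 {1..<Suc l}" by auto
    then show ?thesis by simp
  qed
  finally show ?thesis by (simp add: orbit_mset_def l)
qed

context
  fixes f :: "'b \<Rightarrow> 'b" and X :: "'b multiset"
  assumes inv: "image_mset f X = X"
begin

text \<open>Invariance makes \<open>f\<close> map the finite support onto itself, and a surjection
  of a finite set onto itself is injective.\<close>

lemma invariant_mset_inj_on: "inj_on f (set_mset X)"
proof (rule eq_card_imp_inj_on)
  have "f ` set_mset X = set_mset X" using inv by (metis set_image_mset)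
  then show "card (f ` set_mset X) = card (set_mset X)" by simp
qed simp

lemma invariant_mset_step:
  assumes "x \<in># X"
  shows "f x \<in># X" "count X (f x) = count X x"
proof -
  show "f x \<in># X" using assms inv by (metis imageI set_image_mset)
  have "count (image_mset f X) (f x) = sum (count X) {x' \<in> set_mset X. f x' = f x}"
    by (simp add: count_image_mset Int_def conj_commute)
  also have "{x' \<in> set_mset X. f x' = f x} = {x}"
    using assms invariant_mset_inj_on by (auto dest: inj_onD)
  finally show "count X (f x) = count X x" using inv by simp
qed

lemma invariant_mset_funpow:
  assumes "x \<in># X"
  shows "(f ^^ t) x \<in># X" "count X ((f ^^ t) x) = count X x"
  by (induction t) (use assms invariant_mset_step in auto)

text \<open>The forward orbit stays in the finite support, so it repeats; injectivity on the support
  cancels the common initial part of the two exponents.\<close>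

lemma invariant_mset_periodic:
  assumes "x \<in># X"
  obtains k where "0 < k" "(f ^^ k) x = x"
proof -
  have "(\<lambda>t. (f ^^ t) x) ` UNIV \<subseteq> set_mset X"
    using invariant_mset_funpow(1)[OF assms] by blast
  then have "finite (range (\<lambda>t. (f ^^ t) x))"
    using finite_subset by blast
  then have "\<not> inj (\<lambda>t. (f ^^ t) x)" using finite_imageD infinite_UNIV_nat by blast
  then obtain i j where "i < j" "(f ^^ i) x = (f ^^ j) x"
    by (metis linorder_injI)
  moreover have "(f ^^ i) y = (f ^^ i) x \<Longrightarrow> y = x" if "y \<in># X" for y i
    using that
  proof (induction i)
    case (Suc i)
    have "(f ^^ i) y = (f ^^ i) x"
      using Suc.prems invariant_mset_inj_on invariant_mset_funpow(1)[OF assms]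
        invariant_mset_funpow(1)[OF \<open>y \<in># X\<close>]
      by (auto dest: inj_onD)
    then show ?case using Suc by simp
  qed simp
  moreover have "(f ^^ j) x = (f ^^ i) ((f ^^ (j - i)) x)" if "i < j" for i j
    using that by (metis comp_apply funpow_add le_add_diff_inverse less_imp_le)
  ultimately have "(f ^^ (j - i)) x = x" using invariant_mset_funpow(1)[OF assms] by metis
  then show ?thesis using that[of "j - i"] \<open>i < j\<close> by simp
qed

text \<open>Multiplicities in \<open>X\<close> are constant along an orbit, so \<open>s\<close>
  copies of the whole orbit fit as soon as \<open>s\<close> copies of \<open>x\<close> do.\<close>

lemma repeat_orbit_mset_subset:
  assumes "x \<in># X" "s \<le> count X x"
  shows "repeat_mset s (orbit_mset f x) \<subseteq># X"
proof (rule mset_subset_eqI)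
  fix y
  obtain k where k: "0 < k" "(f ^^ k) x = x"
    using invariant_mset_periodic[OF assms(1)] by blast
  show "count (repeat_mset s (orbit_mset f x)) y \<le> count X y"
  proof (cases "y \<in># orbit_mset f x")
    case True
    then obtain t where "y = (f ^^ t) x" by (auto simp: set_orbit_mset)
    then have "count X y = count X x" using invariant_mset_funpow[OF assms(1)] by simp
    then show ?thesis using count_orbit_mset_le[OF k, of y] assms(2)
      by (simp add: mult_le_mono[of s "count X x" "count (orbit_mset f x) y" 1, simplified])
  next
    case False
    then show ?thesis by (simp add: not_in_iff)
  qed
qed

end

subsection \<open>Multisets of necklaces\<close>

definition word_shift :: "(nat \<Rightarrow> 'a) \<Rightarrow> nat \<Rightarrow> 'a" where
  "word_shift x = (\<lambda>t. x (Suc t))"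

lemma word_shift_funpow: "(word_shift ^^ k) x = (\<lambda>t. x (k + t))"
  by (induction k) (auto simp: word_shift_def)

abbreviation period :: "(nat \<Rightarrow> 'a) \<Rightarrow> nat" where
  "period \<equiv> least_power word_shift"

text \<open>A finite word of length \<open>k\<close> is encoded by its infinite repetition. The word
  is primitive iff the period is \<open>k\<close>, and \<open>k div period x\<close> is its
  exponent.\<close>

definition periodic_words :: "'a set \<Rightarrow> nat \<Rightarrow> (nat \<Rightarrow> 'a) set" where
  "periodic_words I k = {x. range x \<subseteq> I \<and> (word_shift ^^ k) x = x}"

text \<open>A primitive necklace of length \<open>d\<close> is a shift orbit of \<open>d\<close>
  sequences, so these are the multisets of primitive necklaces of total length
  \<open>n\<close>.\<close>

definition necklace_msets :: "'a set \<Rightarrow> nat \<Rightarrow> (nat \<Rightarrow> 'a) multiset set" where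
  "necklace_msets I n = {X. size X = n \<and> image_mset word_shift X = X \<and> (\<forall>x\<in>#X. range x \<subseteq> I)}"

definition word_weight :: "('a \<Rightarrow> real) \<Rightarrow> nat \<Rightarrow> (nat \<Rightarrow> 'a) \<Rightarrow> real" where
  "word_weight p k x = (\<Prod>t<k. p (x t))"

text \<open>Only first letters enter: along an orbit they run once through the letters of the
  necklace, so this is the product of the probabilities of all letters.\<close>

definition mset_weight :: "('a \<Rightarrow> real) \<Rightarrow> (nat \<Rightarrow> 'a) multiset \<Rightarrow> real" where
  "mset_weight p X = (\<Prod>x\<in>#X. p (x 0))"

text \<open>An orbit of \<open>d\<close> sequences contributes \<open>d\<close> terms
  \<open>1 / d\<close>, so necklaces are counted with multiplicity.\<close>

definition necklace_count :: "(nat \<Rightarrow> 'a) multiset \<Rightarrow> real" where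
  "necklace_count X = (\<Sum>x\<in>#X. 1 / real (period x))"

lemma image_mset_repeat_mset: "image_mset f (repeat_mset s X) = repeat_mset s (image_mset f X)"
  by (induction s) simp_all

lemma in_repeat_mset: "x \<in># repeat_mset s X \<longleftrightarrow> 0 < s \<and> x \<in># X"
  by (simp flip: count_greater_zero_iff)

lemma mset_weight_union: "mset_weight p (X + Y) = mset_weight p X * mset_weight p Y"
  by (simp add: mset_weight_def)

lemma mset_weight_repeat: "mset_weight p (repeat_mset s X) = mset_weight p X ^ s"
  by (induction s) (simp_all add: mset_weight_union, simp add: mset_weight_def)

lemma necklace_count_union: "necklace_count (X + Y) = necklace_count X + necklace_count Y"
  by (simp add: necklace_count_def)

lemma necklace_count_repeat: "necklace_count (repeat_mset s X) = of_nat s * necklace_count X"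
  by (induction s) (simp_all add: necklace_count_union algebra_simps, simp add: necklace_count_def)

lemma mset_weight_orbit: "mset_weight p (orbit_mset word_shift x) = word_weight p (period x) x"
  by (simp add: mset_weight_def orbit_mset_def word_weight_def image_mset.compositionality comp_def
      word_shift_funpow prod_unfold_prod_mset)

lemma necklace_count_orbit:
  assumes "0 < k" "(word_shift ^^ k) x = x"
  shows "necklace_count (orbit_mset word_shift x) = 1"
proof -
  have "0 < period x" using least_powerI(2)[of k word_shift x] assms by simp
  then show ?thesis
    by (simp add: necklace_count_def orbit_mset_def image_mset.compositionality comp_def
        least_power_funpow[OF assms] flip: sum_unfold_sum_mset)
qed

text \<open>The first \<open>s * d\<close> letters split into \<open>s\<close> blocks of length
  \<open>d\<close>, each a copy of the first one.\<close>

lemma word_weight_mult: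
  assumes "(word_shift ^^ d) x = x"
  shows "word_weight p (s * d) x = word_weight p d x ^ s"
proof -
  have per: "x (m * d + t) = x t" for m t
  proof (induction m)
    case (Suc m)
    have "x (d + (m * d + t)) = x (m * d + t)"
      using fun_cong[OF assms, of "m * d + t"] by (simp add: word_shift_funpow)
    then show ?case using Suc by (simp add: add.assoc)
  qed simp
  have block: "(\<Prod>t\<in>{m*d..<m*d+d}. p (x t)) = word_weight p d x" for m
  proof -
    have "(\<Prod>t\<in>{0+m*d..<d+m*d}. p (x t)) = (\<Prod>t\<in>{0..<d}. p (x (t + m*d)))"
      by (rule prod.shift_bounds_nat_ivl)
    also have "\<dots> = (\<Prod>t\<in>{0..<d}. p (x t))"
      using per[of m] by (simp add: add.commute)
    finally show ?thesis by (simp add: add.commute word_weight_def lessThan_atLeast0)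
  qed
  have "word_weight p (s * d) x = (\<Prod>m<s. \<Prod>t\<in>{m*d..<m*d+d}. p (x t))"
    by (simp add: word_weight_def prod.nat_group)
  also have "\<dots> = word_weight p d x ^ s" by (simp add: block)
  finally show ?thesis .
qed

text \<open>A triple \<open>(X, x, s)\<close> amounts to a marked element of \<open>X\<close>, namely the \<open>s\<close>-th copy of \<open>x\<close>.\<close>

lemma bij_betw_remove_necklaces:
  "bij_betw (\<lambda>(k, x, X). (X + repeat_mset (k div period x) (orbit_mset word_shift x), x, k div period x))
     (SIGMA k:{1..n}. periodic_words I k \<times> necklace_msets I (n - k))
     (SIGMA X:necklace_msets I n. SIGMA x:set_mset X. {1..count X x})"
  (is "bij_betw ?f ?A ?B")
proof -
  \<comment> \<open>The inverse map removes \<open>s\<close> copies of the orbit of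
    \<open>x\<close>. They consist of \<open>s * period x\<close> sequences, which determines
    \<open>k\<close>.\<close>
  define g :: "(nat \<Rightarrow> 'a) multiset \<times> (nat \<Rightarrow> 'a) \<times> nat \<Rightarrow> nat \<times> (nat \<Rightarrow> 'a) \<times> (nat \<Rightarrow> 'a) multiset"
    where "g = (\<lambda>(X, x, s). (s * period x, x, X - repeat_mset s (orbit_mset word_shift x)))"
  show ?thesis
  proof (rule bij_betw_byWitness[where f' = g])
    show "\<forall>a\<in>?A. g (?f a) = a"
    proof
      fix a assume "a \<in> ?A"
      then obtain k x X where a: "a = (k, x, X)" and 1: "x \<in> periodic_words I k" by auto
      from 1 have "period x dvd k"
        by (intro least_power_minimal) (auto simp: periodic_words_def)
      then show "g (?f a) = a" by (simp add: g_def a)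
    qed
    have per_pos: "0 < period x" if "X \<in> necklace_msets I n" "x \<in># X" for X x
      using that invariant_mset_periodic[of word_shift X x] least_powerI(2)[of _ word_shift x]
      by (auto simp: necklace_msets_def)
    show "\<forall>b\<in>?B. ?f (g b) = b"
    proof
      fix b assume "b \<in> ?B"
      then obtain X x s where b: "b = (X, x, s)"
        and 1: "X \<in> necklace_msets I n" "x \<in># X" "s \<in> {1..count X x}" by auto
      then have "repeat_mset s (orbit_mset word_shift x) \<subseteq># X"
        by (intro repeat_orbit_mset_subset) (auto simp: necklace_msets_def)
      then show "?f (g b) = b" using per_pos[OF 1(1,2)] by (simp add: g_def b)
    qed
    show "?f ` ?A \<subseteq> ?B"
    proof
      fix b assume "b \<in> ?f ` ?A"
      then obtain k x X where b: "b = ?f (k, x, X)" and 1: "k \<in> {1..n}" "x \<in> periodic_words I k"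
        "X \<in> necklace_msets I (n - k)" by blast
      from 1 have k: "0 < k" "k \<le> n" "(word_shift ^^ k) x = x" "range x \<subseteq> I" by (auto simp: periodic_words_def)
      have X: "size X = n - k" "image_mset word_shift X = X" "\<And>y. y \<in># X \<Longrightarrow> range y \<subseteq> I"
        using 1 by (auto simp: necklace_msets_def)
      define s where "s = k div period x"
      have dvd: "period x dvd k" by (intro least_power_minimal k)
      then have s: "s * period x = k" "0 < s" using k by (auto simp: s_def)
      have "size (X + repeat_mset s (orbit_mset word_shift x)) = n" using X s k by simp
      moreover have "image_mset word_shift (X + repeat_mset s (orbit_mset word_shift x))
          = X + repeat_mset s (orbit_mset word_shift x)"
        using X(2) image_orbit_mset[OF k(1,3)] by (simp add: image_mset_repeat_mset)
      moreover have "range y \<subseteq> I" if "y \<in># X + repeat_mset s (orbit_mset word_shift x)" for y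
        using that X(3)[of y] k(4) by (auto simp: set_orbit_mset word_shift_funpow in_repeat_mset)
      \<comment> \<open>The inserted orbits alone already contain \<open>x\<close> with multiplicity
        \<open>s\<close>, whatever \<open>X\<close> contributes.\<close>
      moreover have "s \<in> {1..count (X + repeat_mset s (orbit_mset word_shift x)) x}"
        using self_in_orbit_mset[OF k(1,3)] s by (auto simp: Suc_le_eq intro!: trans_le_add2)
      ultimately show "b \<in> ?B"
        using s self_in_orbit_mset[OF k(1,3)]
        by (simp add: b s_def[symmetric] necklace_msets_def in_repeat_mset)
    qed
    show "g ` ?B \<subseteq> ?A"
    proof
      fix a assume "a \<in> g ` ?B"
      then obtain X x s where a: "a = g (X, x, s)"
        and 1: "X \<in> necklace_msets I n" "x \<in># X" "s \<in> {1..count X x}" by auto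
      then have X: "size X = n" "image_mset word_shift X = X" "\<And>y. y \<in># X \<Longrightarrow> range y \<subseteq> I"
        by (auto simp: necklace_msets_def)
      have sub: "repeat_mset s (orbit_mset word_shift x) \<subseteq># X"
        using 1 X by (intro repeat_orbit_mset_subset) auto
      obtain k where k: "0 < k" "(word_shift ^^ k) x = x"
        using invariant_mset_periodic[OF X(2) 1(2)] by blast
      have "(word_shift ^^ (s * period x)) x = x"
        using funpow_fixed_iff_least_power_dvd[OF k] by simp
      moreover have "s * period x \<le> n"
        using size_mset_mono[OF sub] X by simp
      moreover have "0 < s * period x" using 1 per_pos[OF 1(1,2)] by simp
      moreover have "size (X - repeat_mset s (orbit_mset word_shift x)) = n - s * period x"
        using X sub by (simp add: size_Diff_submset)
      moreover have "image_mset word_shift (X - repeat_mset s (orbit_mset word_shift x))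
          = X - repeat_mset s (orbit_mset word_shift x)"
        using X(2) image_orbit_mset[OF k] sub by (simp add: image_mset_Diff image_mset_repeat_mset)
      ultimately show "a \<in> ?A"
        using X(3) 1(2) by (auto simp: a g_def periodic_words_def necklace_msets_def Suc_le_eq dest!: in_diffD)
    qed
  qed
qed

text \<open>The inserted copies carry \<open>k\<close> letters in \<open>k div period x\<close>
  necklaces. Weight and exponential of the count therefore factor along the bijection, which turns a
  sum over marked multisets into a convolution.\<close>

lemma weight_insert_necklaces:
  assumes "0 < k" "x \<in> periodic_words I k"
  shows "mset_weight p (X + repeat_mset (k div period x) (orbit_mset word_shift x))
      = word_weight p k x * mset_weight p X"
    and "necklace_count (X + repeat_mset (k div period x) (orbit_mset word_shift x))
      = real (k div period x) + necklace_count X"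
proof -
  have x: "(word_shift ^^ k) x = x" using assms by (simp add: periodic_words_def)
  have "k div period x * period x = k" using least_power_minimal[OF x] by simp
  moreover have "(word_shift ^^ period x) x = x" using least_powerI(1)[of k word_shift x] x assms by simp
  ultimately have "word_weight p k x = word_weight p (period x) x ^ (k div period x)"
    using word_weight_mult[of "period x" x p "k div period x"] by simp
  then show "mset_weight p (X + repeat_mset (k div period x) (orbit_mset word_shift x))
      = word_weight p k x * mset_weight p X"
    by (simp add: mset_weight_union mset_weight_repeat mset_weight_orbit)
  show "necklace_count (X + repeat_mset (k div period x) (orbit_mset word_shift x))
      = real (k div period x) + necklace_count X"
    by (simp add: necklace_count_union necklace_count_repeat necklace_count_orbit[OF assms(1) x])
qed

subsection \<open>Generating functions of random necklaces\<close>

text \<open>The notation \<open>abs_summable_on\<close> is ambiguous here: two theories of infinite sums declare it.\<close>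

abbreviation norm_summable_on :: "('b \<Rightarrow> 'c :: real_normed_vector) \<Rightarrow> 'b set \<Rightarrow> bool" (infix "norm'_summable'_on" 46)
  where "f norm_summable_on A \<equiv> (\<lambda>x. norm (f x)) summable_on A"

lemma abs_summable_has_sum_times:
  fixes u :: "'b \<Rightarrow> complex" and v :: "'c \<Rightarrow> complex"
  assumes u: "u norm_summable_on A" and v: "v norm_summable_on B"
  shows "(\<lambda>(x, y). u x * v y) norm_summable_on A \<times> B"
    and "((\<lambda>(x, y). u x * v y) has_sum infsum u A * infsum v B) (A \<times> B)"
proof -
  show *: "(\<lambda>(x, y). u x * v y) norm_summable_on A \<times> B"
    unfolding Infinite_Sum.abs_summable_on_Sigma_iff using u v
    by (auto simp: norm_mult infsum_cmult_right' infsum_nonneg intro!: summable_on_cmult_right summable_on_cmult_left)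
  have "((\<lambda>x. u x * infsum v B) has_sum infsum u A * infsum v B) A"
    by (rule has_sum_cmult_left[OF has_sum_infsum[OF Infinite_Sum.abs_summable_summable[OF u]]])
  moreover have "((\<lambda>y. u x * v y) has_sum u x * infsum v B) B" for x
    by (rule has_sum_cmult_right[OF has_sum_infsum[OF Infinite_Sum.abs_summable_summable[OF v]]])
  ultimately show "((\<lambda>(x, y). u x * v y) has_sum infsum u A * infsum v B) (A \<times> B)"
    using Infinite_Sum.abs_summable_summable[OF *] by (intro has_sum_SigmaI[where g = "\<lambda>x. u x * infsum v B"]) auto
qed

lemma norm_exp_minus_1_le: "norm (exp w - 1) \<le> norm w * exp (norm w)" for w :: complex
  using Taylor_exp_field[of w 0] by (simp add: mult.commute)

locale letter_distribution =
  fixes I :: "'a set" and p :: "'a \<Rightarrow> real" and R :: real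
  assumes prob_nonneg: "\<And>i. i \<in> I \<Longrightarrow> 0 \<le> p i"
    and prob_has_sum: "(p has_sum 1) I"
    and prob_le: "\<And>i. i \<in> I \<Longrightarrow> p i \<le> R"
    and R_pos: "0 < R" and R_less: "R < 1"
begin

lemma prod_prob_has_sum:
  assumes "finite A"
  shows "((\<lambda>g. \<Prod>x\<in>A. p (g x)) has_sum 1) (PiE A (\<lambda>_. I))"
proof -
  have "p norm_summable_on I"
    using has_sum_imp_summable[OF prob_has_sum] by (rule Infinite_Sum.summable_on_iff_abs_summable_on_real[THEN iffD1])
  then have "infsum (\<lambda>g. \<Prod>x\<in>A. p (g x)) (PiE A (\<lambda>_. I)) = (\<Prod>x\<in>A. infsum p I)"
    by (intro Infinite_Sum.infsum_prod_PiE_abs[OF assms, where f = "\<lambda>_. p"])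
  also have "\<dots> = 1" using prob_has_sum by (simp add: infsumI)
  finally have eq: "infsum (\<lambda>g. \<Prod>x\<in>A. p (g x)) (PiE A (\<lambda>_. I)) = 1" .
  \<comment> \<open>A sum that does not exist has \<open>infsum\<close> equal to 0, so the value 1
    certifies summability.\<close>
  then have "(\<lambda>g. \<Prod>x\<in>A. p (g x)) summable_on PiE A (\<lambda>_. I)"
    using infsum_not_exists[of "\<lambda>g. \<Prod>x\<in>A. p (g x)" "PiE A (\<lambda>_. I)"] by auto
  then show ?thesis using has_sum_infsum eq by metis
qed

lemma word_weight_nonneg: "range x \<subseteq> I \<Longrightarrow> 0 \<le> word_weight p k x"
  by (auto simp: word_weight_def intro!: prod_nonneg prob_nonneg)

text \<open>A \<open>k\<close>-periodic sequence is determined by its first \<open>k\<close>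
  letters, which can be chosen freely, so this is the total mass of a product distribution.\<close>

lemma word_weight_has_sum:
  assumes "0 < k"
  shows "(word_weight p k has_sum 1) (periodic_words I k)"
proof -
  have per: "x (t mod k) = x t" if "(word_shift ^^ k) x = x" for x :: "nat \<Rightarrow> 'a" and t
  proof -
    have "x (m * k + s) = x s" for m s
    proof (induction m)
      case (Suc m)
      have "x (k + (m * k + s)) = x (m * k + s)"
        using fun_cong[OF that, of "m * k + s"] by (simp add: word_shift_funpow)
      then show ?case using Suc by (simp add: add.assoc)
    qed simp
    then show ?thesis by (metis div_mult_mod_eq)
  qed
  have "(word_weight p k has_sum 1) (periodic_words I k)
      = ((\<lambda>g. \<Prod>x\<in>{..<k}. p (g x)) has_sum 1) (PiE {..<k} (\<lambda>_. I))"
  proof (rule has_sum_reindex_bij_witness[where i = "\<lambda>w t. w (t mod k)" and j = "\<lambda>x. restrict x {..<k}"])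
    show "(\<lambda>t. restrict a {..<k} (t mod k)) = a" if "a \<in> periodic_words I k" for a
    proof
      fix t
      have "a (t mod k) = a t" by (rule per) (use that in \<open>simp add: periodic_words_def\<close>)
      then show "restrict a {..<k} (t mod k) = a t" using assms by simp
    qed
    show "restrict a {..<k} \<in> {..<k} \<rightarrow>\<^sub>E I" if "a \<in> periodic_words I k" for a
      using that by (auto simp: periodic_words_def)
    show "(\<lambda>t. b (t mod k)) \<in> periodic_words I k" if "b \<in> {..<k} \<rightarrow>\<^sub>E I" for b
    proof -
      have "b (t mod k) \<in> I" for t using PiE_mem[OF that, of "t mod k"] assms by simp
      then show ?thesis by (auto simp: periodic_words_def word_shift_funpow)
    qed
    show "restrict (\<lambda>t. b (t mod k)) {..<k} = b" if "b \<in> {..<k} \<rightarrow>\<^sub>E I" for b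
    proof
      fix t show "restrict (\<lambda>t. b (t mod k)) {..<k} t = b t"
        by (cases "t < k") (simp_all add: PiE_arb[OF that])
    qed
  qed (auto simp: word_weight_def)
  then show ?thesis using prod_prob_has_sum[of "{..<k}"] by simp
qed

text \<open>This is \<open>q k\<close>: \<open>word_weight p k\<close> is the law of a random word
  of length \<open>k\<close>, and \<open>k div period x\<close> is the exponent of that
  word.\<close>

definition word_gf :: "nat \<Rightarrow> complex \<Rightarrow> complex" where
  "word_gf k z = infsum (\<lambda>x. of_real (word_weight p k x) * exp (of_nat (k div period x) * z)) (periodic_words I k)"

definition mset_term :: "complex \<Rightarrow> (nat \<Rightarrow> 'a) multiset \<Rightarrow> complex" where
  "mset_term z X = of_real (mset_weight p X) * exp (of_real (necklace_count X) * z)"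

text \<open>So far merely a weighted sum; it becomes an expectation only after the weights are shown
  to have total mass 1 and are matched with the words.\<close>

definition mset_gf :: "nat \<Rightarrow> complex \<Rightarrow> complex" where
  "mset_gf n z = infsum (mset_term z) (necklace_msets I n)"

lemma word_gf_abs_summable:
  fixes z :: complex
  assumes "0 < k"
  shows "(\<lambda>x. of_real (word_weight p k x) * exp (of_nat (k div period x) * z)) norm_summable_on periodic_words I k"
proof (rule Infinite_Sum.abs_summable_on_comparison_test')
  show "(\<lambda>x. word_weight p k x * exp (real k * norm z)) summable_on periodic_words I k"
    using has_sum_imp_summable[OF word_weight_has_sum[OF assms]] by (rule summable_on_cmult_left)
  fix x assume "x \<in> periodic_words I k"
  then have "0 \<le> word_weight p k x" by (auto simp: periodic_words_def intro!: word_weight_nonneg)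
  moreover have "norm (exp (of_nat (k div period x) * z)) \<le> exp (real k * norm z)"
    using div_le_dividend[of k "period x"]
    by (intro order.trans[OF norm_exp]) (auto simp: norm_mult intro!: mult_right_mono)
  ultimately show "norm (complex_of_real (word_weight p k x) * exp (of_nat (k div period x) * z))
      \<le> word_weight p k x * exp (real k * norm z)"
    by (auto simp: norm_mult intro!: mult_left_mono)
qed

text \<open>The terms of the marked multisets are summed in two ways. Each \<open>X\<close> admits
  \<open>n\<close> marks, which gives the left side; removing the marked necklaces gives the
  convolution. Absolute summability travels the same route, from smaller sizes through the bijection
  and back to the unmarked multisets, so both claims share one induction step.\<close>

lemma mset_gf_step:
  assumes IH: "\<And>m. m < n \<Longrightarrow> mset_term z norm_summable_on necklace_msets I m" and n: "0 < n"
  shows "mset_term z norm_summable_on necklace_msets I n"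
    and "of_nat n * mset_gf n z = (\<Sum>k=1..n. word_gf k z * mset_gf (n - k) z)"
proof -
  let ?A = "SIGMA k:{1..n}. periodic_words I k \<times> necklace_msets I (n - k)"
  let ?B = "SIGMA X:necklace_msets I n. SIGMA x:set_mset X. {1..count X x}"
  define ins where "ins = (\<lambda>(k, x :: nat \<Rightarrow> 'a, X). (X + repeat_mset (k div period x) (orbit_mset word_shift x), x, k div period x))"
  define h where "h = (\<lambda>k (x, X). of_real (word_weight p k x) * exp (of_nat (k div period x) * z) * mset_term z X)"
  define c where "c = (\<lambda>(X, _ :: (nat \<Rightarrow> 'a) \<times> nat). mset_term z X)"
  have bij: "bij_betw ins ?A ?B"
    unfolding ins_def by (rule bij_betw_remove_necklaces)
  have h_c: "c (ins a) = (case a of (k, y) \<Rightarrow> h k y)" if a_in: "a \<in> ?A" for a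
  proof -
    obtain k x X where a: "a = (k, x, X)" and kx: "0 < k" "x \<in> periodic_words I k"
      using a_in by (cases a) auto
    show ?thesis
      unfolding a c_def ins_def h_def mset_term_def prod.case weight_insert_necklaces[OF kx]
      by (simp add: ring_distribs exp_add)
  qed
  have hk: "h k norm_summable_on periodic_words I k \<times> necklace_msets I (n - k)"
    "(h k has_sum word_gf k z * mset_gf (n - k) z) (periodic_words I k \<times> necklace_msets I (n - k))"
    if "k \<in> {1..n}" for k
    using that n unfolding h_def word_gf_def mset_gf_def
    by (intro abs_summable_has_sum_times word_gf_abs_summable IH; simp)+
  have abs_A: "(\<lambda>(k, y). h k y) norm_summable_on ?A"
    by (rule Infinite_Sum.abs_summable_on_Sigma_iff[THEN iffD2]) (use hk(1) in auto)
  have "((\<lambda>(k, y). h k y) has_sum (\<Sum>k=1..n. word_gf k z * mset_gf (n - k) z)) ?A"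
  proof (rule has_sum_SigmaI[OF _ _ Infinite_Sum.abs_summable_summable[OF abs_A]])
    show "((\<lambda>y. case (k, y) of (k, y) \<Rightarrow> h k y) has_sum word_gf k z * mset_gf (n - k) z)
        (periodic_words I k \<times> necklace_msets I (n - k))" if "k \<in> {1..n}" for k
      using hk(2)[OF that] by simp
  qed (simp add: has_sum_finite)
  also have "?this \<longleftrightarrow> ((\<lambda>a. c (ins a)) has_sum (\<Sum>k=1..n. word_gf k z * mset_gf (n - k) z)) ?A"
    by (intro has_sum_cong) (use h_c in auto)
  also have "\<dots> \<longleftrightarrow> (c has_sum (\<Sum>k=1..n. word_gf k z * mset_gf (n - k) z)) ?B"
    by (rule has_sum_reindex_bij_betw[OF bij])
  finally have sum_B: "(c has_sum (\<Sum>k=1..n. word_gf k z * mset_gf (n - k) z)) ?B" .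
  have "(\<lambda>a. norm (c (ins a))) summable_on ?A"
    using abs_A by (rule summable_on_cong[THEN iffD1, rotated]) (use h_c in auto)
  then have abs_B: "c norm_summable_on ?B"
    by (rule summable_on_reindex_bij_betw[OF bij, of "\<lambda>b. norm (c b)", THEN iffD1])
  \<comment> \<open>The marks of \<open>X\<close> number \<open>size X = n\<close>. The value type
    is left open because the fact is applied both to real norms and to complex terms.\<close>
  have inner: "((\<lambda>_. d) has_sum of_nat n * d) (SIGMA x:set_mset X. {1..count X x})"
    if "X \<in> necklace_msets I n" for X and d :: "'d :: real_normed_algebra_1"
  proof (rule has_sum_finiteI)
    show "finite (SIGMA x:set_mset X. {1..count X x})" by simp
    have "card (SIGMA x:set_mset X. {1..count X x}) = size X"
      by (subst card_SigmaI) (auto simp: size_multiset_overloaded_eq)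
    then show "of_nat n * d = sum (\<lambda>_. d) (SIGMA x:set_mset X. {1..count X x})"
      using that by (simp only: sum_constant) (simp add: necklace_msets_def)
  qed
  have "(\<lambda>X. infsum (\<lambda>y. norm (c (X, y))) (SIGMA x:set_mset X. {1..count X x}))
      norm_summable_on necklace_msets I n"
    using abs_B unfolding Infinite_Sum.abs_summable_on_Sigma_iff by blast
  then have "(\<lambda>X. norm (real n * norm (mset_term z X))) summable_on necklace_msets I n"
  proof (rule summable_on_cong[THEN iffD1, rotated])
    fix X assume "X \<in> necklace_msets I n"
    then show "norm (infsum (\<lambda>y. norm (c (X, y))) (SIGMA x:set_mset X. {1..count X x}))
        = norm (real n * norm (mset_term z X))"
      unfolding c_def prod.case using infsumI[OF inner[of X "norm (mset_term z X)"]] by (simp only:)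
  qed
  then have "(\<lambda>X. real n * norm (mset_term z X)) summable_on necklace_msets I n"
    by simp
  then show *: "mset_term z norm_summable_on necklace_msets I n"
    using n summable_on_cmult_right[of "\<lambda>X. real n * norm (mset_term z X)" _ "1 / real n"] by simp
  have "((\<lambda>X. of_nat n * mset_term z X) has_sum (\<Sum>k=1..n. word_gf k z * mset_gf (n - k) z)) (necklace_msets I n)"
    by (rule has_sum_SigmaD[OF sum_B]) (simp only: c_def prod.case inner)
  moreover have "((\<lambda>X. of_nat n * mset_term z X) has_sum of_nat n * mset_gf n z) (necklace_msets I n)"
    unfolding mset_gf_def by (rule has_sum_cmult_right[OF has_sum_infsum[OF Infinite_Sum.abs_summable_summable[OF *]]])
  ultimately show "of_nat n * mset_gf n z = (\<Sum>k=1..n. word_gf k z * mset_gf (n - k) z)"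
    using has_sum_unique by blast
qed

lemma necklace_msets_0: "necklace_msets I 0 = {{#}}"
  by (auto simp: necklace_msets_def)

lemma mset_term_empty: "mset_term z {#} = 1"
  by (simp add: mset_term_def mset_weight_def necklace_count_def)

lemma mset_term_abs_summable: "mset_term z norm_summable_on necklace_msets I n"
proof (induction n rule: less_induct)
  case (less n)
  show ?case
  proof (cases "n = 0")
    case True
    then show ?thesis by (simp add: necklace_msets_0)
  next
    case False
    show ?thesis by (rule mset_gf_step(1)[OF less.IH]) (use False in simp_all)
  qed
qed

lemma mset_gf_0: "mset_gf 0 z = 1"
  by (simp add: mset_gf_def necklace_msets_0 mset_term_empty)

lemma mset_gf_rec: "of_nat n * mset_gf n z = (\<Sum>k=1..n. word_gf k z * mset_gf (n - k) z)"
proof (cases "n = 0")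
  case False
  show ?thesis by (rule mset_gf_step(2)[OF mset_term_abs_summable]) (use False in simp)
qed simp

lemma word_gf_at_0:
  assumes "0 < k"
  shows "word_gf k 0 = 1"
  using infsumI[OF has_sum_of_real[OF word_weight_has_sum[OF assms], where 'a = complex]]
  by (simp add: word_gf_def)

text \<open>With all \<open>q k\<close> equal to 1 the recursion says that each value is the average
  of the preceding ones, and the initial value is 1.\<close>

lemma mset_gf_at_0: "mset_gf n 0 = 1"
proof (induction n rule: less_induct)
  case (less n)
  show ?case
  proof (cases "n = 0")
    case False
    have "of_nat n * mset_gf n 0 = (\<Sum>k=1..n. (1::complex))"
      unfolding mset_gf_rec by (intro sum.cong) (use less in \<open>auto simp: word_gf_at_0\<close>)
    then show ?thesis using False by simp
  qed (simp add: mset_gf_0)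
qed

lemma mset_weight_has_sum: "(mset_weight p has_sum 1) (necklace_msets I n)"
proof -
  have "(mset_term 0 has_sum mset_gf n 0) (necklace_msets I n)"
    unfolding mset_gf_def
    by (rule has_sum_infsum[OF Infinite_Sum.abs_summable_summable[OF mset_term_abs_summable]])
  then have "((\<lambda>X. Re (mset_term 0 X)) has_sum Re (mset_gf n 0)) (necklace_msets I n)"
    by (rule has_sum_Re)
  then show ?thesis by (simp add: mset_term_def mset_gf_at_0)
qed

text \<open>A proper period \<open>d\<close> of a word of length \<open>k\<close> divides
  \<open>k\<close>, hence is at most \<open>k / 2\<close>. The \<open>k - d\<close> letters after
  the first \<open>d\<close> are then forced and cost a factor at most \<open>R ^ (k - d)\<close>,
  which is at most \<open>sqrt R ^ k\<close>. The first \<open>d\<close> letters have total mass at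
  most 1, and there are at most \<open>k\<close> choices of \<open>d\<close>.\<close>

lemma non_primitive_weight_le:
  assumes "0 < k" "finite F" "F \<subseteq> periodic_words I k"
  shows "(\<Sum>x\<in>{x\<in>F. period x \<noteq> k}. word_weight p k x) \<le> real k * sqrt R ^ k"
proof -
  define D where "D = {d. d dvd k \<and> d < k}"
  have D_sub: "D \<subseteq> {..<k}" by (auto simp: D_def)
  then have fin_D: "finite D" by (rule finite_subset) simp
  have x: "range x \<subseteq> I" "(word_shift ^^ k) x = x" "0 < period x" "(word_shift ^^ period x) x = x" "period x dvd k"
    if "x \<in> F" for x
    using that assms least_powerI[of k word_shift x] least_power_minimal[of k word_shift x]
    by (auto simp: periodic_words_def)
  have wt: "word_weight p k x \<le> sqrt R ^ k * word_weight p (period x) x"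
    if "x \<in> F" "period x \<noteq> k" for x
  proof -
    let ?d = "period x"
    from x(5)[OF that(1)] obtain m where m: "k = ?d * m" by blast
    with that assms(1) have "2 \<le> m" by (cases m; cases "m - 1") auto
    then have le: "2 * ?d \<le> k" using m by (metis mult.commute mult_le_mono1)
    have split: "word_weight p k x = word_weight p ?d x * (\<Prod>t\<in>{?d..<k}. p (x t))"
      unfolding word_weight_def using le by (subst prod.union_disjoint[symmetric]) (auto intro!: prod.cong)
    have "(\<Prod>t\<in>{?d..<k}. p (x t)) \<le> (\<Prod>t\<in>{?d..<k}. R)"
      using x(1)[OF that(1)] by (intro prod_mono) (auto intro!: prob_nonneg prob_le)
    also have "\<dots> = sqrt R ^ (2 * (k - ?d))" using R_pos by (simp add: power_mult)
    also have "\<dots> \<le> sqrt R ^ k" using R_pos R_less le by (intro power_decreasing) auto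
    finally have "(\<Prod>t\<in>{?d..<k}. p (x t)) \<le> sqrt R ^ k" .
    then have "word_weight p ?d x * (\<Prod>t\<in>{?d..<k}. p (x t)) \<le> word_weight p ?d x * sqrt R ^ k"
      by (rule mult_left_mono[OF _ word_weight_nonneg[OF x(1)[OF that(1)]]])
    then show ?thesis using split by (simp add: mult.commute)
  qed
  have "(\<Sum>x\<in>{x\<in>F. period x \<noteq> k}. word_weight p k x)
      \<le> (\<Sum>x\<in>{x\<in>F. period x \<noteq> k}. sqrt R ^ k * word_weight p (period x) x)"
    by (intro sum_mono) (use wt in auto)
  also have "\<dots> = (\<Sum>d\<in>D. \<Sum>x\<in>{x\<in>{x\<in>F. period x \<noteq> k}. period x = d}. sqrt R ^ k * word_weight p (period x) x)"
  proof (rule sum.group[symmetric, OF _ fin_D])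
    show "finite {x\<in>F. period x \<noteq> k}" using assms(2) by simp
    show "period ` {x\<in>F. period x \<noteq> k} \<subseteq> D"
    proof
      fix d assume "d \<in> period ` {x\<in>F. period x \<noteq> k}"
      then obtain y where y: "y \<in> F" "period y \<noteq> k" "d = period y" by blast
      then show "d \<in> D" using x(5)[OF y(1)] dvd_imp_le[OF x(5)[OF y(1)] assms(1)] by (simp add: D_def)
    qed
  qed
  also have "\<dots> \<le> (\<Sum>d\<in>D. sqrt R ^ k)"
  proof (intro sum_mono)
    fix d assume "d \<in> D"
    then have d: "0 < d" using assms(1) by (auto simp: D_def intro!: Nat.gr0I)
    let ?G = "{x\<in>{x\<in>F. period x \<noteq> k}. period x = d}"
    have "(\<Sum>x\<in>?G. word_weight p d x) \<le> 1"
      using assms(2) x(1,4) d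
      by (intro finite_sum_le_has_sum[OF word_weight_has_sum[OF d]])
         (auto simp: periodic_words_def intro!: word_weight_nonneg)
    then have "sqrt R ^ k * (\<Sum>x\<in>?G. word_weight p d x) \<le> sqrt R ^ k * 1"
      using R_pos by (intro mult_left_mono) auto
    then show "(\<Sum>x\<in>?G. sqrt R ^ k * word_weight p (period x) x) \<le> sqrt R ^ k"
      by (simp add: sum_distrib_left)
  qed
  also have "\<dots> \<le> real k * sqrt R ^ k"
    using card_mono[OF _ D_sub] R_pos by (simp add: mult_right_mono)
  finally show ?thesis .
qed

text \<open>A primitive word contributes exactly \<open>exp z\<close>, so only non-primitive words
  enter the difference. The factor \<open>norm z\<close> is kept, since it makes the perturbation
  vanish in the limit where \<open>z\<close> tends to 0.\<close>

lemma word_gf_bound: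
  assumes "0 < k"
  shows "norm (word_gf k z - exp z) \<le> norm z * (real k)\<^sup>2 * (sqrt R * exp (norm z)) ^ k"
proof -
  \<comment> \<open>A bound for \<open>norm (exp (m * z) - exp z)\<close> over all possible
    exponents \<open>1 \<le> m \<le> k\<close>.\<close>
  define b where "b = real k * norm z * exp (real k * norm z)"
  define g where "g = (\<lambda>x. of_real (word_weight p k x) * (exp (of_nat (k div period x) * z) - exp z))"
  have g_le: "norm (g x) \<le> (if period x \<noteq> k then b * word_weight p k x else 0)"
    if x: "x \<in> periodic_words I k" for x
  proof -
    have k: "period x dvd k" using least_power_minimal[of k word_shift x] x by (auto simp: periodic_words_def)
    define m where "m = k div period x"
    have "k = period x * m" using k by (simp add: m_def)
    then have m: "1 \<le> m" "m \<le> k" using assms by (cases m; cases "period x"; simp)+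
    have wt: "0 \<le> word_weight p k x" using x by (auto simp: periodic_words_def intro!: word_weight_nonneg)
    obtain j where j: "m = Suc j" using m by (cases m) auto
    have "exp (of_nat m * z) - exp z = exp z * (exp (of_nat j * z) - 1)"
      by (simp add: j ring_distribs exp_add)
    then have "norm (exp (of_nat m * z) - exp z)
        \<le> exp (norm z) * (norm (of_nat j * z) * exp (norm (of_nat j * z)))"
      by (simp only: norm_mult[of "exp z"]) (intro mult_mono norm_exp norm_exp_minus_1_le; simp)
    also have "\<dots> = real j * norm z * exp (real m * norm z)"
      by (simp add: j norm_mult ring_distribs exp_add)
    also have "\<dots> \<le> b"
      unfolding b_def using m j by (intro mult_mono) (auto intro!: mult_right_mono)
    finally have "norm (exp (of_nat m * z) - exp z) \<le> b" .
    then have "word_weight p k x * norm (exp (of_nat m * z) - exp z) \<le> word_weight p k x * b"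
      using wt by (rule mult_left_mono)
    moreover have "m = 1" if "period x = k" using that assms by (simp add: m_def)
    ultimately show ?thesis using wt by (simp add: g_def norm_mult flip: m_def) (simp add: mult.commute)
  qed
  have fin: "(\<Sum>x\<in>F. norm (g x)) \<le> b * (real k * sqrt R ^ k)"
    if "finite F" "F \<subseteq> periodic_words I k" for F
  proof -
    have "(\<Sum>x\<in>F. norm (g x)) \<le> (\<Sum>x\<in>F. if period x \<noteq> k then b * word_weight p k x else 0)"
      by (intro sum_mono g_le) (use that in auto)
    also have "\<dots> = b * (\<Sum>x\<in>{x\<in>F. period x \<noteq> k}. word_weight p k x)"
      using that by (simp add: sum.inter_filter[symmetric] sum_distrib_left)
    also have "\<dots> \<le> b * (real k * sqrt R ^ k)"
      by (intro mult_left_mono non_primitive_weight_le assms that) (simp add: b_def)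
    finally show ?thesis .
  qed
  \<comment> \<open>The word weights have total mass 1, so \<open>exp z\<close> may be subtracted
    term by term.\<close>
  have g_sum: "(g has_sum word_gf k z - exp z) (periodic_words I k)"
  proof -
    have "((\<lambda>x. of_real (word_weight p k x) * - exp z) has_sum of_real 1 * - exp z) (periodic_words I k)"
      by (intro has_sum_cmult_left has_sum_of_real word_weight_has_sum assms)
    with has_sum_infsum[OF Infinite_Sum.abs_summable_summable[OF word_gf_abs_summable[OF assms, of z]]]
    have "((\<lambda>x. of_real (word_weight p k x) * exp (of_nat (k div period x) * z) + of_real (word_weight p k x) * - exp z)
       has_sum word_gf k z + of_real 1 * - exp z) (periodic_words I k)"
      unfolding word_gf_def by (rule has_sum_add)
    then show ?thesis by (simp add: g_def right_diff_distrib)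
  qed
  have "norm (word_gf k z - exp z) \<le> b * (real k * sqrt R ^ k)"
  proof (rule tendsto_upperbound)
    show "((\<lambda>F. norm (sum g F)) \<longlongrightarrow> norm (word_gf k z - exp z)) (finite_subsets_at_top (periodic_words I k))"
      using g_sum unfolding has_sum_def by (rule tendsto_norm)
    show "\<forall>\<^sub>F F in finite_subsets_at_top (periodic_words I k). norm (sum g F) \<le> b * (real k * sqrt R ^ k)"
      by (intro eventually_finite_subsets_at_top_weakI order.trans[OF norm_sum fin])
  qed simp
  also have "\<dots> = norm z * (real k)\<^sup>2 * (sqrt R * exp (norm z)) ^ k"
    by (simp add: b_def power2_eq_square power_mult_distrib exp_of_nat_mult mult_ac)
  finally show ?thesis .
qed

end

subsection \<open>Perturbation of the cycle generating function of uniform permutations\<close>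

text \<open>The recursion is the coefficientwise form of a prescribed logarithmic derivative. The
  coefficient at 0 is set to 0 because the sum starts at \<open>k = 1\<close>.\<close>

lemma fps_logderiv_iff:
  fixes f q :: "nat \<Rightarrow> complex"
  shows "(\<forall>n. of_nat n * f n = (\<Sum>k=1..n. q k * f (n - k))) \<longleftrightarrow>
    fps_X * fps_deriv (Abs_fps f) = Abs_fps (\<lambda>k. if k = 0 then 0 else q k) * Abs_fps f"
proof -
  have l: "fps_nth (fps_X * fps_deriv (Abs_fps f)) n = of_nat n * f n" for n
    by (cases n) auto
  have r: "fps_nth (Abs_fps (\<lambda>k. if k = 0 then 0 else q k) * Abs_fps f) n = (\<Sum>k=1..n. q k * f (n - k))" for n
  proof -
    have "fps_nth (Abs_fps (\<lambda>k. if k = 0 then 0 else q k) * Abs_fps f) n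
        = (\<Sum>k=0..n. (if k = 0 then 0 else q k) * f (n - k))"
      by (simp add: fps_mult_nth)
    also have "\<dots> = (\<Sum>k=1..n. q k * f (n - k))"
      by (intro sum.mono_neutral_cong_right) auto
    finally show ?thesis .
  qed
  show ?thesis unfolding fps_eq_iff l r ..
qed

text \<open>Dividing power series subtracts logarithmic derivatives, so the quotient
  \<open>h\<close> of \<open>f\<close> by \<open>a\<close> satisfies the recursion with coefficients
  \<open>q k - u k\<close>.\<close>

lemma logderiv_rec_convolution:
  fixes f a q u :: "nat \<Rightarrow> complex"
  assumes f: "\<And>n. of_nat n * f n = (\<Sum>k=1..n. q k * f (n - k))" and f0: "f 0 = 1"
    and a: "\<And>n. of_nat n * a n = (\<Sum>k=1..n. u k * a (n - k))" and a0: "a 0 = 1"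
  obtains h where "h 0 = 1" "\<And>n. of_nat n * h n = (\<Sum>k=1..n. (q k - u k) * h (n - k))"
    "\<And>n. f n = (\<Sum>j=0..n. h j * a (n - j))"
proof -
  define F A Q U where "F = Abs_fps f" and "A = Abs_fps a"
    and "Q = Abs_fps (\<lambda>k. if k = 0 then 0 else q k)" and "U = Abs_fps (\<lambda>k. if k = 0 then 0 else u k)"
  define H where "H = F * inverse A"
  have A0: "fps_nth A 0 \<noteq> 0" by (simp add: A_def a0)
  then have "A \<noteq> 0" by auto
  have FA: "F = H * A" using A0 by (simp add: H_def mult.assoc inverse_mult_eq_1)
  have eqF: "fps_X * fps_deriv F = Q * F"
    unfolding F_def Q_def using fps_logderiv_iff[of f q] f by blast
  have eqA: "fps_X * fps_deriv A = U * A"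
    unfolding A_def U_def using fps_logderiv_iff[of a u] a by blast
  have "fps_X * fps_deriv F = A * (fps_X * fps_deriv H) + H * (fps_X * fps_deriv A)"
    by (simp add: FA algebra_simps)
  then have "A * (fps_X * fps_deriv H) = A * ((Q - U) * H)"
    unfolding eqF eqA by (simp add: FA algebra_simps)
  then have "fps_X * fps_deriv H = (Q - U) * H" using \<open>A \<noteq> 0\<close> by simp
  moreover have "Q - U = Abs_fps (\<lambda>k. if k = 0 then 0 else q k - u k)"
    by (auto simp: Q_def U_def fps_eq_iff)
  ultimately have "\<forall>n. of_nat n * fps_nth H n = (\<Sum>k=1..n. (q k - u k) * fps_nth H (n - k))"
    by (subst fps_logderiv_iff) (simp add: fps_nth_inverse)
  moreover have "fps_nth H 0 = 1" by (simp add: H_def F_def A_def f0 a0)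
  moreover have "f n = (\<Sum>j=0..n. fps_nth H j * a (n - j))" for n
  proof -
    have "f n = fps_nth F n" by (simp add: F_def)
    then show ?thesis by (simp add: FA fps_mult_nth A_def)
  qed
  ultimately show ?thesis using that by blast
qed

text \<open>The rising factorial \<open>u * (u + 1) * ... * (u + n - 1)\<close> divided by
  \<open>n!\<close>, that is, the probability generating function of the cycle count of a uniform
  permutation.\<close>

definition ewens_gf :: "complex \<Rightarrow> nat \<Rightarrow> complex" where
  "ewens_gf u n = (\<Prod>k=1..n. 1 + (u - 1) / of_nat k)"

lemma ewens_gf_0: "ewens_gf u 0 = 1"
  by (simp add: ewens_gf_def)

lemma ewens_gf_Suc: "ewens_gf u (Suc n) = ewens_gf u n * (1 + (u - 1) / of_nat (Suc n))"
  by (simp add: ewens_gf_def)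

text \<open>With the summation reversed, passing from \<open>n\<close> to \<open>n + 1\<close> adds
  the single term \<open>u * ewens_gf u n\<close>, which matches the new factor
  \<open>(n + u) / (n + 1)\<close>.\<close>

lemma ewens_gf_rec: "of_nat n * ewens_gf u n = (\<Sum>k=1..n. u * ewens_gf u (n - k))"
proof -
  have "of_nat n * ewens_gf u n = (\<Sum>k<n. u * ewens_gf u k)" for n
  proof (induction n)
    case (Suc n)
    have "of_nat (Suc n) * ewens_gf u (Suc n) = of_nat n * ewens_gf u n + u * ewens_gf u n"
      unfolding ewens_gf_Suc by (simp add: field_simps del: of_nat_Suc) (simp add: algebra_simps)
    then show ?case by (simp add: Suc)
  qed simp
  also have "(\<Sum>k<n. u * ewens_gf u k) = (\<Sum>k=1..n. u * ewens_gf u (n - k))"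
    by (rule sum.reindex_bij_witness[of _ "\<lambda>k. n - k" "\<lambda>k. n - k"]) auto
  finally show ?thesis .
qed

text \<open>Every further factor has modulus at least \<open>1 - \<tau>\<close>. This lets earlier
  values occurring in a convolution be measured against the last one, as a relative error bound
  requires.\<close>

lemma ewens_gf_ratio:
  assumes "norm (u - 1) \<le> \<tau>" "\<tau> < 1"
  shows "norm (ewens_gf u m) * (1 - \<tau>) ^ j \<le> norm (ewens_gf u (m + j))"
proof (induction j)
  case (Suc j)
  have "norm ((u - 1) / of_nat (Suc (m + j))) \<le> norm (u - 1) / 1"
    unfolding norm_divide by (intro divide_left_mono) (auto simp del: of_nat_Suc)
  then have "1 - \<tau> \<le> norm (1 + (u - 1) / of_nat (Suc (m + j)))"
    using norm_diff_ineq[of 1 "(u - 1) / of_nat (Suc (m + j))"] assms by (simp del: of_nat_Suc)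
  then have "norm (ewens_gf u m) * (1 - \<tau>) ^ j * (1 - \<tau>)
      \<le> norm (ewens_gf u (m + j)) * norm (1 + (u - 1) / of_nat (Suc (m + j)))"
    using Suc assms by (intro mult_mono) auto
  then show ?case by (simp add: ewens_gf_Suc norm_mult mult_ac del: of_nat_Suc)
qed simp

text \<open>Each of the \<open>n\<close> summands is at most \<open>x * \<kappa> ^ n\<close>, and
  the factor \<open>n\<close> on the left absorbs their number. Because \<open>x \<le> 1\<close>,
  the earlier values, including \<open>h 0 = 1\<close>, are bounded by the plain powers of
  \<open>\<kappa>\<close>.\<close>

lemma geometric_majorant:
  fixes h e :: "nat \<Rightarrow> complex"
  assumes "h 0 = 1" "\<And>n. of_nat n * h n = (\<Sum>k=1..n. e k * h (n - k))"
    and e: "\<And>k. 0 < k \<Longrightarrow> norm (e k) \<le> x * \<kappa> ^ k" and x: "0 \<le> x" "x \<le> 1" and "0 \<le> \<kappa>"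
  shows "0 < n \<Longrightarrow> norm (h n) \<le> x * \<kappa> ^ n"
proof (induction n rule: less_induct)
  case (less n)
  have h: "norm (h m) \<le> \<kappa> ^ m" if "m < n" for m
  proof (cases "m = 0")
    case False
    then have "norm (h m) \<le> x * \<kappa> ^ m" using less.IH that by simp
    also have "\<dots> \<le> 1 * \<kappa> ^ m" using assms by (intro mult_right_mono) auto
    finally show ?thesis by simp
  qed (simp add: assms)
  have "real n * norm (h n) = norm (of_nat n * h n)" by (simp add: norm_mult)
  also have "\<dots> \<le> (\<Sum>k=1..n. norm (e k * h (n - k)))"
    unfolding assms(2) by (rule norm_sum)
  also have "\<dots> \<le> (\<Sum>k=1..n. x * \<kappa> ^ n)"
  proof (intro sum_mono)
    fix k assume k: "k \<in> {1..n}"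
    have "norm (e k * h (n - k)) \<le> (x * \<kappa> ^ k) * \<kappa> ^ (n - k)"
      unfolding norm_mult using k e[of k] h[of "n - k"] assms by (intro mult_mono) auto
    then show "norm (e k * h (n - k)) \<le> x * \<kappa> ^ n"
      using k by (simp add: mult.assoc flip: power_add)
  qed
  finally have "real n * norm (h n) \<le> real n * (x * \<kappa> ^ n)" by simp
  then show ?case using less.prems by simp
qed

text \<open>Write \<open>f\<close> as the convolution of \<open>ewens_gf u\<close> with a sequence
  \<open>h\<close>. The term \<open>h 0 = 1\<close> gives the main term; the others decay like
  \<open>\<kappa> ^ j\<close>, and going back \<open>j\<close> places in \<open>ewens_gf\<close>
  costs at most \<open>(1 - \<tau>) ^ - j\<close>, which leaves a geometric series in
  \<open>\<theta>\<close>.\<close>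

lemma perturbed_rec_bound:
  fixes f q :: "nat \<Rightarrow> complex"
  assumes f: "\<And>n. of_nat n * f n = (\<Sum>k=1..n. q k * f (n - k))" and f0: "f 0 = 1"
    and q: "\<And>k. 0 < k \<Longrightarrow> norm (q k - u) \<le> x * \<kappa> ^ k"
    and x: "0 \<le> x" "x \<le> 1" and \<kappa>: "0 \<le> \<kappa>"
    and \<tau>: "norm (u - 1) \<le> \<tau>" "\<tau> < 1" and \<theta>: "\<kappa> \<le> \<theta> * (1 - \<tau>)" "0 \<le> \<theta>" "\<theta> < 1"
  shows "norm (f n - ewens_gf u n) \<le> x / (1 - \<theta>) * norm (ewens_gf u n)"
proof -
  obtain h where h: "h 0 = 1" "\<And>n. of_nat n * h n = (\<Sum>k=1..n. (q k - u) * h (n - k))"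
    "\<And>n. f n = (\<Sum>j=0..n. h j * ewens_gf u (n - j))"
    using logderiv_rec_convolution[OF f f0 ewens_gf_rec[where u = u] ewens_gf_0] by blast
  have hn: "norm (h n) \<le> x * \<kappa> ^ n" if "0 < n" for n
    by (rule geometric_majorant[OF h(1,2)]) (use q x \<kappa> that in auto)
  have "f n - ewens_gf u n = (\<Sum>j=1..n. h j * ewens_gf u (n - j))"
    unfolding h(3) by (subst sum.atLeast_Suc_atMost) (simp_all add: h(1))
  also have "norm \<dots> \<le> (\<Sum>j=1..n. x * \<theta> ^ j * norm (ewens_gf u n))"
  proof (intro order.trans[OF norm_sum] sum_mono)
    fix j assume j: "j \<in> {1..n}"
    have "norm (h j * ewens_gf u (n - j)) \<le> (x * (\<theta> * (1 - \<tau>)) ^ j) * norm (ewens_gf u (n - j))"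
      unfolding norm_mult using j x \<kappa> \<theta>
      by (intro mult_right_mono order.trans[OF hn] mult_left_mono power_mono) auto
    also have "\<dots> = x * \<theta> ^ j * (norm (ewens_gf u (n - j)) * (1 - \<tau>) ^ j)"
      by (simp add: power_mult_distrib)
    also have "\<dots> \<le> x * \<theta> ^ j * norm (ewens_gf u n)"
      using ewens_gf_ratio[OF \<tau>, of "n - j" j] j x \<theta> by (intro mult_left_mono) auto
    finally show "norm (h j * ewens_gf u (n - j)) \<le> x * \<theta> ^ j * norm (ewens_gf u n)" .
  qed
  also have "\<dots> = x * (\<Sum>j=1..n. \<theta> ^ j) * norm (ewens_gf u n)"
    by (simp add: sum_distrib_left sum_distrib_right)
  also have "(\<Sum>j=1..n. \<theta> ^ j) \<le> 1 / (1 - \<theta>)"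
  proof -
    have "(\<Sum>j=1..n. \<theta> ^ j) \<le> (\<Sum>j. \<theta> ^ j)"
      using \<theta> by (intro sum_le_suminf summable_geometric) auto
    then show ?thesis using \<theta> by (simp add: suminf_geometric)
  qed
  then have "x * (\<Sum>j=1..n. \<theta> ^ j) * norm (ewens_gf u n) \<le> x * (1 / (1 - \<theta>)) * norm (ewens_gf u n)"
    using x by (intro mult_right_mono mult_left_mono) auto
  finally show ?thesis by simp
qed

text \<open>The point is that \<open>C\<close> and \<open>\<delta>\<close> depend on
  \<open>r\<close> alone, so they serve all letter distributions with the same bound at
  once.\<close>

lemma perturbed_rec_bound_uniform:
  assumes r: "0 < r" "r < 1"
  obtains C \<delta> :: real where "0 \<le> C" "0 < \<delta>"
    "\<And>f q z n. \<lbrakk>norm z \<le> \<delta>; f 0 = 1; \<And>n. of_nat n * f n = (\<Sum>k=1..n. q k * f (n - k));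
       \<And>k. 0 < k \<Longrightarrow> norm (q k - exp z) \<le> norm z * (real k)\<^sup>2 * (r * exp (norm z)) ^ k\<rbrakk>
     \<Longrightarrow> norm (f n - ewens_gf (exp z) n) \<le> C * norm z * norm (ewens_gf (exp z) n)"
proof -
  \<comment> \<open>Equally spaced between \<open>r\<close> and 1: the gap from \<open>r\<close> to
    \<open>r1\<close> absorbs \<open>exp (norm z)\<close>, the gap up to \<open>\<kappa>\<close>
    absorbs the factor \<open>k * k\<close>, the gap up to \<open>\<theta>\<close> absorbs
    \<open>1 - \<tau>\<close>, and the last one makes the geometric series converge.\<close>
  define r1 \<kappa> \<theta> where "r1 = (3 * r + 1) / 4" and "\<kappa> = (r + 1) / 2" and "\<theta> = (r + 3) / 4"
  have ord: "r < r1" "r1 < \<kappa>" "\<kappa> < \<theta>" "\<theta> < 1" "0 < r1"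
    using r by (auto simp: r1_def \<kappa>_def \<theta>_def)
  define y where "y = r1 / \<kappa>"
  have y: "0 < y" "y < 1" using ord by (auto simp: y_def)
  have "(\<lambda>k. (real k)\<^sup>2 * y ^ k) \<longlonglongrightarrow> 0" using y by real_asymp
  then have "Bseq (\<lambda>k. (real k)\<^sup>2 * y ^ k)" by (intro convergent_imp_Bseq convergentI)
  then obtain B where B: "\<And>k. norm ((real k)\<^sup>2 * y ^ k) \<le> B" "0 < B"
    unfolding Bseq_def by blast
  define \<tau> where "\<tau> = 1 - \<kappa> / \<theta>"
  have \<tau>: "0 < \<tau>" "\<tau> < 1" using ord by (auto simp: \<tau>_def)
  \<comment> \<open>In this order the bounds ensure \<open>exp (norm z) \<le> exp 1\<close>,
    \<open>B * norm z \<le> 1\<close>, \<open>r * exp (norm z) \<le> r1\<close> and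
    \<open>norm (exp z - 1) \<le> \<tau>\<close>.\<close>
  define \<delta> where "\<delta> = min (min 1 (1 / B)) (min (ln (r1 / r)) (\<tau> / exp 1))"
  have \<delta>: "0 < \<delta>" "\<delta> \<le> 1" "\<delta> \<le> 1 / B" "\<delta> \<le> ln (r1 / r)" "\<delta> \<le> \<tau> / exp 1"
    using ord r \<tau> B by (auto simp: \<delta>_def)
  show thesis
  proof (rule that[of "B / (1 - \<theta>)" \<delta>])
    fix f q :: "nat \<Rightarrow> complex" and z n
    assume z: "norm z \<le> \<delta>" and f0: "f 0 = 1"
      and f: "\<And>n. of_nat n * f n = (\<Sum>k=1..n. q k * f (n - k))"
      and q: "\<And>k. 0 < k \<Longrightarrow> norm (q k - exp z) \<le> norm z * (real k)\<^sup>2 * (r * exp (norm z)) ^ k"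
    have "exp (norm z) \<le> exp (ln (r1 / r))" using z \<delta> by simp
    then have rz: "r * exp (norm z) \<le> y * \<kappa>" using r ord by (simp add: y_def field_simps)
    have bd: "norm (q k - exp z) \<le> (B * norm z) * \<kappa> ^ k" if "0 < k" for k
    proof -
      have "norm (q k - exp z) \<le> norm z * (real k)\<^sup>2 * (y * \<kappa>) ^ k"
        using rz r by (intro order.trans[OF q[OF that]] mult_left_mono power_mono) auto
      also have "\<dots> = norm z * ((real k)\<^sup>2 * y ^ k) * \<kappa> ^ k"
        by (simp add: power_mult_distrib)
      also have "\<dots> \<le> norm z * B * \<kappa> ^ k"
        using B(1)[of k] y ord by (intro mult_right_mono mult_left_mono) auto
      finally show ?thesis by (simp add: mult_ac)
    qed
    have "norm (exp z - 1) \<le> norm z * exp (norm z)" by (rule norm_exp_minus_1_le)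
    also have "\<dots> \<le> (\<tau> / exp 1) * exp 1" using z \<delta> by (intro mult_mono) auto
    finally have u: "norm (exp z - 1) \<le> \<tau>" by simp
    have "norm (f n - ewens_gf (exp z) n) \<le> (B * norm z) / (1 - \<theta>) * norm (ewens_gf (exp z) n)"
    proof (rule perturbed_rec_bound[OF f f0 bd _ _ _ u])
      have "B * norm z \<le> B * (1 / B)" using z \<delta> B by (intro mult_left_mono) auto
      then show "B * norm z \<le> 1" using B by simp
    qed (use B ord \<tau> in \<open>auto simp: \<tau>_def\<close>)
    then show "norm (f n - ewens_gf (exp z) n) \<le> B / (1 - \<theta>) * norm z * norm (ewens_gf (exp z) n)"
      by simp
  qed (use B ord \<delta> in auto)
qed

text \<open>Here \<open>L\<close> plays the role of \<open>ln n\<close>. The three errors come from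
  replacing \<open>Ln (1 + w)\<close> by \<open>w\<close> (controlled by the sum of inverse
  squares), \<open>exp z - 1\<close> by its second-order Taylor polynomial, and the harmonic number
  by \<open>L\<close>.\<close>

lemma ewens_exponent_bound:
  assumes z: "norm z \<le> 1 / 8" and S: "\<And>n. (\<Sum>k=1..n. 1 / (real k)\<^sup>2) \<le> S"
    and E: "\<bar>harm n - L\<bar> \<le> B" and y: "norm z \<le> y" and L: "0 \<le> L"
  defines "t \<equiv> exp z - 1"
  shows "norm ((\<Sum>k=1..n. Ln (1 + t / of_nat k)) - z * of_real L - z\<^sup>2 / 2 * of_real L)
    \<le> 8 * S * y\<^sup>2 + 3 * y ^ 3 * (L + B) + (y + y\<^sup>2) * B"
proof -
  have e3: "exp (norm z) \<le> 2"
  proof -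
    have "exp (norm z) \<le> 1 + norm z + (norm z)\<^sup>2" using z by (intro exp_bound) auto
    also have "(norm z)\<^sup>2 \<le> norm z * 1" unfolding power2_eq_square using z by (intro mult_left_mono) auto
    finally show ?thesis using z by simp
  qed
  have y0: "0 \<le> y" using y norm_ge_zero order.trans by blast
  have "norm t \<le> norm z * exp (norm z)" unfolding t_def by (rule norm_exp_minus_1_le)
  also have "\<dots> \<le> norm z * 2" by (intro mult_left_mono e3) auto
  finally have t: "norm t \<le> 2 * norm z" by simp
  have Ln_le: "norm (Ln (1 + t / of_nat k) - t / of_nat k) \<le> 2 * (norm t)\<^sup>2 * (1 / (real k)\<^sup>2)"
    if "1 \<le> k" for k
  proof -
    let ?w = "t / of_nat k"
    have "norm ?w \<le> norm t / 1" unfolding norm_divide using that by (intro divide_left_mono) auto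
    then have w: "norm ?w \<le> 1 / 2" using t z by simp
    then have "norm (Ln (1 + ?w) - ?w) \<le> (norm ?w)\<^sup>2 / (1 - norm ?w)"
      by (intro Ln_approx_linear) simp
    also have "\<dots> \<le> (norm ?w)\<^sup>2 / (1 / 2)" using w by (intro divide_left_mono) auto
    finally show ?thesis by (simp add: norm_divide power_divide mult.commute)
  qed
  have "norm ((\<Sum>k=1..n. Ln (1 + t / of_nat k)) - (\<Sum>k=1..n. t / of_nat k))
      \<le> (\<Sum>k=1..n. 2 * (norm t)\<^sup>2 * (1 / (real k)\<^sup>2))"
    unfolding sum_subtractf[symmetric] by (intro order.trans[OF norm_sum] sum_mono Ln_le) auto
  also have "\<dots> \<le> 2 * (norm t)\<^sup>2 * S"
    unfolding sum_distrib_left[symmetric] by (intro mult_left_mono S) auto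
  also have "\<dots> \<le> 2 * (2 * y)\<^sup>2 * S"
    using t y S[of 0] by (intro mult_right_mono mult_left_mono power_mono) auto
  finally have 1: "norm ((\<Sum>k=1..n. Ln (1 + t / of_nat k)) - (\<Sum>k=1..n. t / of_nat k)) \<le> 8 * S * y\<^sup>2"
    by (simp add: power2_eq_square mult_ac)
  have th: "(\<Sum>k=1..n. t / of_nat k) = t * of_real (harm n)"
    by (simp add: harm_def sum_distrib_left divide_inverse)
  have "norm (exp z - (\<Sum>i\<le>2. z ^ i / fact i)) \<le> exp (norm z) * norm z ^ Suc 2 / fact 2"
    by (rule Taylor_exp_field)
  also have "(\<Sum>i\<le>2. z ^ i / fact i) = 1 + z + z\<^sup>2 / 2"
    by (simp add: numeral_2_eq_2)
  also have "exp (norm z) * norm z ^ Suc 2 / fact 2 \<le> 2 * y ^ 3 / 2"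
  proof -
    have "exp (norm z) * norm z ^ 3 \<le> 2 * y ^ 3" using e3 y by (intro mult_mono power_mono) auto
    then show ?thesis by (simp add: fact_numeral numeral_3_eq_3)
  qed
  finally have "norm (t - z - z\<^sup>2 / 2) \<le> y ^ 3" by (simp add: t_def algebra_simps)
  moreover have "\<bar>harm n\<bar> \<le> L + B" using E L by linarith
  ultimately have 2: "norm ((t - z - z\<^sup>2 / 2) * of_real (harm n)) \<le> y ^ 3 * (L + B)"
    unfolding norm_mult norm_of_real using y0 by (intro mult_mono) (auto simp: harm_nonneg)
  have "norm (z + z\<^sup>2 / 2) \<le> y + y\<^sup>2"
  proof -
    have "norm (z + z\<^sup>2 / 2) \<le> norm z + (norm z)\<^sup>2"
      by (intro order.trans[OF norm_triangle_ineq]) (simp add: norm_power norm_divide)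
    also have "\<dots> \<le> y + y\<^sup>2" using y by (intro add_mono power_mono) auto
    finally show ?thesis .
  qed
  then have 3: "norm ((z + z\<^sup>2 / 2) * of_real (harm n - L)) \<le> (y + y\<^sup>2) * B"
    unfolding norm_mult norm_of_real using E y0 by (intro mult_mono) auto
  have "(\<Sum>k=1..n. Ln (1 + t / of_nat k)) - z * of_real L - z\<^sup>2 / 2 * of_real L
     = ((\<Sum>k=1..n. Ln (1 + t / of_nat k)) - (\<Sum>k=1..n. t / of_nat k))
       + ((t - z - z\<^sup>2 / 2) * of_real (harm n) + (z + z\<^sup>2 / 2) * of_real (harm n - L))"
    unfolding th by (simp add: field_simps)
  also have "norm \<dots> \<le> 8 * S * y\<^sup>2 + (y ^ 3 * (L + B) + (y + y\<^sup>2) * B)"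
    by (intro norm_triangle_le add_mono 1 order.trans[OF norm_triangle_ineq] 2 3)
  also have "y ^ 3 * (L + B) \<le> 3 * y ^ 3 * (L + B)"
    using y0 L E by (simp add: mult_right_mono)
  finally show ?thesis by simp
qed

text \<open>With \<open>z = s / sqrt (ln n)\<close> the logarithm of the product is
  \<open>z * ln n + z * z / 2 * ln n\<close> up to a vanishing error. The first term is cancelled by
  the centring factor and the second equals \<open>s * s / 2\<close>.\<close>

lemma ewens_gf_limit:
  "uniform_limit (cball 0 \<rho>)
     (\<lambda>n s. exp (- s * of_real (sqrt (ln (real n)))) * ewens_gf (exp (s / of_real (sqrt (ln (real n))))) n)
     (\<lambda>s. exp (s\<^sup>2 / 2)) sequentially"
proof (cases "0 \<le> \<rho>")
  case True
  have "summable (\<lambda>k. 1 / (real (Suc k))\<^sup>2)"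
    using sums_summable[OF inverse_squares_sums] by simp
  define S where "S = (\<Sum>k. 1 / (real (Suc k))\<^sup>2)"
  have S: "(\<Sum>k=1..n. 1 / (real k)\<^sup>2) \<le> S" for n
  proof -
    have "(\<Sum>k=1..n. 1 / (real k)\<^sup>2) = (\<Sum>k<n. 1 / (real (Suc k))\<^sup>2)"
      by (rule sum.reindex_bij_witness[of _ Suc "\<lambda>k. k - 1"]) auto
    also have "\<dots> \<le> S"
      unfolding S_def by (intro sum_le_suminf \<open>summable _\<close>) auto
    finally show ?thesis .
  qed
  have "Bseq (\<lambda>n. harm n - ln (real n))"
    using euler_mascheroni_LIMSEQ by (intro convergent_imp_Bseq convergentI)
  then obtain B where B: "\<And>n. \<bar>harm n - ln (real n)\<bar> \<le> B" "0 < B"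
    unfolding Bseq_def real_norm_def by blast
  define y where "y n = \<rho> / sqrt (ln (real n))" for n
  \<comment> \<open>\<open>y n\<close> bounds \<open>norm z\<close> uniformly on the disc, and
    \<open>e n\<close> is the resulting error of the exponent.\<close>
  define e where "e n = 8 * S * (y n)\<^sup>2 + 3 * (y n) ^ 3 * (ln (real n) + B) + (y n + (y n)\<^sup>2) * B" for n
  have y_lim: "y \<longlonglongrightarrow> 0" unfolding y_def by real_asymp
  have e_lim: "e \<longlonglongrightarrow> 0"
  proof (rule Lim_transform_eventually)
    \<comment> \<open>The critical term is the cubic one times \<open>ln n\<close>; by the choice of
      \<open>y\<close> it is \<open>y n\<close> times the square of \<open>\<rho>\<close>, hence
      still vanishes.\<close>
    show "(\<lambda>n. 8 * S * (y n)\<^sup>2 + 3 * (y n * \<rho>\<^sup>2 + (y n) ^ 3 * B) + (y n + (y n)\<^sup>2) * B) \<longlonglongrightarrow> 0"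
      by (rule tendsto_eq_intros y_lim refl | simp)+
    show "\<forall>\<^sub>F n in sequentially. 8 * S * (y n)\<^sup>2 + 3 * (y n * \<rho>\<^sup>2 + (y n) ^ 3 * B) + (y n + (y n)\<^sup>2) * B = e n"
      using eventually_ge_at_top[of 2]
    proof eventually_elim
      case (elim n)
      then have "(y n)\<^sup>2 * ln (real n) = \<rho>\<^sup>2" by (simp add: y_def power_divide)
      then have "(y n) ^ 3 * ln (real n) = y n * \<rho>\<^sup>2" by (simp add: power3_eq_cube power2_eq_square)
      then show ?case by (simp add: e_def algebra_simps)
    qed
  qed
  have "(\<lambda>n. exp (\<rho>\<^sup>2 / 2) * (e n * exp (e n))) \<longlonglongrightarrow> exp (\<rho>\<^sup>2 / 2) * (0 * exp 0)"
    by (intro tendsto_intros e_lim)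
  then have lim: "(\<lambda>n. exp (\<rho>\<^sup>2 / 2) * (e n * exp (e n))) \<longlonglongrightarrow> 0" by simp
  have bound: "norm (exp (- s * of_real (sqrt (ln (real n)))) * ewens_gf (exp (s / of_real (sqrt (ln (real n))))) n
      - exp (s\<^sup>2 / 2)) \<le> exp (\<rho>\<^sup>2 / 2) * (e n * exp (e n))"
    if n: "3 \<le> n" and yn: "y n < 1 / 8" and s: "norm s \<le> \<rho>" for n s
  proof -
    define L where "L = ln (real n)"
    define z where "z = s / of_real (sqrt L)"
    define t where "t = exp z - 1"
    define E where "E = (\<Sum>k=1..n. Ln (1 + t / of_nat k)) - z * of_real L"
    have L: "0 < L" using n by (simp add: L_def)
    have zy: "norm z \<le> y n"
      using s L by (simp add: z_def y_def norm_divide L_def[symmetric] divide_right_mono)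
    have "norm t \<le> norm z * exp (norm z)" unfolding t_def by (rule norm_exp_minus_1_le)
    also have "\<dots> \<le> 1 / 8 * exp 1" using zy yn by (intro mult_mono) auto
    also have "\<dots> < 1" using exp_le by simp
    finally have t: "norm t < 1" .
    \<comment> \<open>The factors of the product do not vanish, so each is the exponential of its
      principal logarithm.\<close>
    have "1 + t / of_nat k \<noteq> 0" if "1 \<le> k" for k
    proof
      assume "1 + t / of_nat k = 0"
      then have "t = - of_nat k" using that by (simp add: field_simps add_eq_0_iff)
      then show False using t that by simp
    qed
    then have ew: "ewens_gf (exp z) n = exp (\<Sum>k=1..n. Ln (1 + t / of_nat k))"
      by (simp add: ewens_gf_def exp_sum t_def)
    have zL: "z * of_real L = s * of_real (sqrt L)"
    proof -
      have "(of_real L :: complex) = of_real (sqrt L) * of_real (sqrt L)"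
        using L by (simp flip: of_real_mult)
      then show ?thesis using L by (simp add: z_def)
    qed
    have z2L: "z\<^sup>2 / 2 * of_real L = s\<^sup>2 / 2"
    proof -
      have "(of_real (sqrt L) :: complex)\<^sup>2 = of_real L" using L by (simp flip: of_real_power)
      then show ?thesis using L by (simp add: z_def power_divide)
    qed
    have "norm (E - s\<^sup>2 / 2) \<le> e n"
      using ewens_exponent_bound[of z S n L B "y n"] zy yn S B(1)[of n] L
      unfolding z2L by (simp add: E_def t_def e_def L_def)
    have "exp (- s * of_real (sqrt L)) * ewens_gf (exp z) n = exp E"
      unfolding ew E_def zL by (simp add: exp_diff exp_minus divide_inverse mult.commute)
    also have "exp E - exp (s\<^sup>2 / 2) = exp (s\<^sup>2 / 2) * (exp (E - s\<^sup>2 / 2) - 1)"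
      by (simp add: exp_diff right_diff_distrib)
    also have "norm \<dots> \<le> exp (\<rho>\<^sup>2 / 2) * (e n * exp (e n))"
      unfolding norm_mult
    proof (intro mult_mono)
      have "(norm s)\<^sup>2 \<le> \<rho>\<^sup>2" using s by (intro power_mono) auto
      then show "norm (exp (s\<^sup>2 / 2)) \<le> exp (\<rho>\<^sup>2 / 2)"
        by (intro order.trans[OF norm_exp]) (simp add: norm_divide norm_power)
      have "norm (exp (E - s\<^sup>2 / 2) - 1) \<le> norm (E - s\<^sup>2 / 2) * exp (norm (E - s\<^sup>2 / 2))"
        by (rule norm_exp_minus_1_le)
      also have "\<dots> \<le> e n * exp (e n)"
        using \<open>norm (E - s\<^sup>2 / 2) \<le> e n\<close> by (intro mult_mono) (auto intro: order.trans[OF norm_ge_zero])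
      finally show "norm (exp (E - s\<^sup>2 / 2) - 1) \<le> e n * exp (e n)" .
    qed auto
    finally show ?thesis by (simp add: z_def L_def)
  qed
  show ?thesis
  proof (rule uniform_limitI)
    fix \<epsilon> :: real assume "0 < \<epsilon>"
    have "\<forall>\<^sub>F n in sequentially. exp (\<rho>\<^sup>2 / 2) * (e n * exp (e n)) < \<epsilon>"
      using lim \<open>0 < \<epsilon>\<close> by (rule order_tendstoD)
    moreover have "\<forall>\<^sub>F n in sequentially. y n < 1 / 8"
      using y_lim by (rule order_tendstoD) simp
    ultimately show "\<forall>\<^sub>F n in sequentially. \<forall>s\<in>cball 0 \<rho>.
        dist (exp (- s * of_real (sqrt (ln (real n)))) * ewens_gf (exp (s / of_real (sqrt (ln (real n))))) n)
          (exp (s\<^sup>2 / 2)) < \<epsilon>"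
      using eventually_ge_at_top[of 3]
      by eventually_elim (auto simp only: dist_norm mem_cball_0 intro: le_less_trans[OF bound])
  qed
qed (simp add: uniform_limit_iff)

text \<open>The first index selects the letter distribution, which may change with \<open>n\<close>;
  the second runs through the recursion. At \<open>z = s / sqrt (ln n)\<close> the relative error is
  of order \<open>norm z\<close>, and the normalized product it multiplies stays bounded on the
  disc.\<close>

lemma perturbed_ewens_limit:
  fixes F Q :: "nat \<Rightarrow> nat \<Rightarrow> complex \<Rightarrow> complex"
  assumes r: "0 < r" "r < 1"
    and F0: "\<And>n z. 1 \<le> n \<Longrightarrow> F n 0 z = 1"
    and rec: "\<And>n m z. 1 \<le> n \<Longrightarrow> of_nat m * F n m z = (\<Sum>k=1..m. Q n k z * F n (m - k) z)"
    and Q: "\<And>n k z. 1 \<le> n \<Longrightarrow> 0 < k \<Longrightarrow>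
      norm (Q n k z - exp z) \<le> norm z * (real k)\<^sup>2 * (r * exp (norm z)) ^ k"
  shows "uniform_limit (cball 0 \<rho>)
     (\<lambda>n s. exp (- s * of_real (sqrt (ln (real n)))) * F n n (s / of_real (sqrt (ln (real n)))))
     (\<lambda>s. exp (s\<^sup>2 / 2)) sequentially"
proof -
  obtain C \<delta> :: real where C: "0 \<le> C" and \<delta>: "0 < \<delta>" and main:
    "\<And>f q z n. \<lbrakk>norm z \<le> \<delta>; f 0 = 1; \<And>n. of_nat n * f n = (\<Sum>k=1..n. q k * f (n - k));
       \<And>k. 0 < k \<Longrightarrow> norm (q k - exp z) \<le> norm z * (real k)\<^sup>2 * (r * exp (norm z)) ^ k\<rbrakk>
     \<Longrightarrow> norm (f n - ewens_gf (exp z) n) \<le> C * norm z * norm (ewens_gf (exp z) n)"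
    using perturbed_rec_bound_uniform[OF r] by blast
  define \<rho>' where "\<rho>' = max \<rho> 0"
  define y where "y n = \<rho>' / sqrt (ln (real n))" for n
  have y_lim: "y \<longlonglongrightarrow> 0" unfolding y_def by real_asymp
  define x where "x n s = exp (- s * of_real (sqrt (ln (real n))))" for n and s :: complex
  define z where "z n s = s / complex_of_real (sqrt (ln (real n)))" for n and s :: complex
  have ew: "uniform_limit (cball 0 \<rho>) (\<lambda>n s. x n s * ewens_gf (exp (z n s)) n) (\<lambda>s. exp (s\<^sup>2 / 2)) sequentially"
    unfolding x_def z_def by (rule ewens_gf_limit)
  have zy: "norm (z n s) \<le> y n" if "norm s \<le> \<rho>" "1 \<le> n" for n s
    using that by (simp add: z_def y_def norm_divide \<rho>'_def divide_right_mono)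
  have bnd: "norm (exp (s\<^sup>2 / 2)) \<le> exp (\<rho>'\<^sup>2 / 2)" if "norm s \<le> \<rho>" for s :: complex
  proof -
    have "(norm s)\<^sup>2 \<le> \<rho>'\<^sup>2" using that by (intro power_mono) (auto simp: \<rho>'_def)
    then show ?thesis by (intro order.trans[OF norm_exp]) (simp add: norm_divide norm_power)
  qed
  have "(\<lambda>n. C * y n * (exp (\<rho>'\<^sup>2 / 2) + 1)) \<longlonglongrightarrow> C * 0 * (exp (\<rho>'\<^sup>2 / 2) + 1)"
    by (intro tendsto_intros y_lim)
  then have lim: "(\<lambda>n. C * y n * (exp (\<rho>'\<^sup>2 / 2) + 1)) \<longlonglongrightarrow> 0" by simp
  have "uniform_limit (cball 0 \<rho>) (\<lambda>n s. x n s * F n n (z n s)) (\<lambda>s. exp (s\<^sup>2 / 2)) sequentially"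
  proof (rule uniform_limitI)
    fix \<epsilon> :: real assume \<epsilon>: "0 < \<epsilon>"
    have "\<forall>\<^sub>F n in sequentially. C * y n * (exp (\<rho>'\<^sup>2 / 2) + 1) < \<epsilon> / 2"
      using lim by (rule order_tendstoD) (use \<epsilon> in simp)
    moreover have "\<forall>\<^sub>F n in sequentially. y n < \<delta>"
      using y_lim \<delta> by (rule order_tendstoD)
    \<comment> \<open>The tolerance 1 keeps the normalized product bounded;
      \<open>\<epsilon> / 2\<close> is its share of the final error.\<close>
    moreover have "\<forall>\<^sub>F n in sequentially. \<forall>s\<in>cball 0 \<rho>.
        dist (x n s * ewens_gf (exp (z n s)) n) (exp (s\<^sup>2 / 2)) < min 1 (\<epsilon> / 2)"
      using uniform_limitD[OF ew, of "min 1 (\<epsilon> / 2)"] \<epsilon> by simp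
    ultimately show "\<forall>\<^sub>F n in sequentially. \<forall>s\<in>cball 0 \<rho>.
        dist (x n s * F n n (z n s)) (exp (s\<^sup>2 / 2)) < \<epsilon>"
      using eventually_ge_at_top[of 1]
    proof eventually_elim
      case (elim n)
      show ?case
      proof
        fix s :: complex assume "s \<in> cball 0 \<rho>"
        then have s: "norm s \<le> \<rho>" by simp
        let ?A = "x n s * ewens_gf (exp (z n s)) n"
        have d: "norm (?A - exp (s\<^sup>2 / 2)) < min 1 (\<epsilon> / 2)"
          using elim(3) \<open>s \<in> cball 0 \<rho>\<close> by (simp add: dist_norm)
        have "norm ?A \<le> norm (exp (s\<^sup>2 / 2)) + norm (?A - exp (s\<^sup>2 / 2))"
          by (metis add.commute diff_add_cancel norm_triangle_ineq)
        moreover have "norm (?A - exp (s\<^sup>2 / 2)) \<le> 1" using d by linarith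
        ultimately have A: "norm ?A \<le> exp (\<rho>'\<^sup>2 / 2) + 1" using bnd[OF s] by linarith
        have "norm (F n n (z n s) - ewens_gf (exp (z n s)) n)
            \<le> C * norm (z n s) * norm (ewens_gf (exp (z n s)) n)"
          by (rule main[where f = "\<lambda>m. F n m (z n s)" and q = "\<lambda>k. Q n k (z n s)"])
             (use elim zy[OF s, of n] F0 rec Q in \<open>auto simp del: of_nat_Suc\<close>)
        then have "norm (x n s) * norm (F n n (z n s) - ewens_gf (exp (z n s)) n)
            \<le> norm (x n s) * (C * norm (z n s) * norm (ewens_gf (exp (z n s)) n))"
          by (intro mult_left_mono) auto
        then have "norm (x n s * F n n (z n s) - ?A) \<le> C * norm (z n s) * norm ?A"
          by (simp add: norm_mult mult_ac flip: right_diff_distrib)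
        also have "\<dots> \<le> C * y n * (exp (\<rho>'\<^sup>2 / 2) + 1)"
          using A C zy[OF s] elim order.trans[OF norm_ge_zero zy[OF s]]
          by (intro mult_mono mult_left_mono mult_nonneg_nonneg) auto
        finally have "norm (x n s * F n n (z n s) - ?A) < \<epsilon> / 2" using elim by simp
        then have "norm ((x n s * F n n (z n s) - ?A) + (?A - exp (s\<^sup>2 / 2))) < \<epsilon> / 2 + \<epsilon> / 2"
          using d by (intro norm_add_less) auto
        then show "dist (x n s * F n n (z n s)) (exp (s\<^sup>2 / 2)) < \<epsilon>" by (simp add: dist_norm)
      qed
    qed
  qed
  then show ?thesis by (simp add: x_def z_def)
qed

subsection \<open>Standardization and backward words\<close>

text \<open>In two sorted listings of one multiset, each last entry also occurs in the other
  listing, so neither is below the other and totality makes them equal. Removing them leaves shorter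
  listings.\<close>

lemma image_mset_sorted_eq:
  assumes total: "\<And>x y. x \<noteq> y \<Longrightarrow> lt x y \<or> lt y x"
    and "image_mset b (mset_set {1..n::nat}) = image_mset c (mset_set {1..n})"
    and "\<And>i j. i \<in> {1..n} \<Longrightarrow> j \<in> {1..n} \<Longrightarrow> i < j \<Longrightarrow> \<not> lt (b j) (b i)"
    and "\<And>i j. i \<in> {1..n} \<Longrightarrow> j \<in> {1..n} \<Longrightarrow> i < j \<Longrightarrow> \<not> lt (c j) (c i)"
  shows "\<forall>i\<in>{1..n}. b i = c i"
  using assms(2-4)
proof (induction n)
  case (Suc n)
  have ins: "{1..Suc n} = insert (Suc n) {1..n}" by auto
  have "set_mset (image_mset b (mset_set {1..Suc n})) = set_mset (image_mset c (mset_set {1..Suc n}))"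
    using Suc.prems(1) by simp
  then have im: "b ` {1..Suc n} = c ` {1..Suc n}" by simp
  have top: "b (Suc n) = c (Suc n)"
  proof (rule ccontr)
    assume neq: "b (Suc n) \<noteq> c (Suc n)"
    have "c (Suc n) \<in> b ` {1..Suc n}" "b (Suc n) \<in> c ` {1..Suc n}"
      using im by (metis atLeastAtMost_iff imageI le_SucI le_refl le_add1 plus_1_eq_Suc)+
    then obtain i j where i: "i \<in> {1..Suc n}" "c (Suc n) = b i"
      and j: "j \<in> {1..Suc n}" "b (Suc n) = c j" by blast
    have "i < Suc n" "j < Suc n" using i j neq by (auto simp: order.order_iff_strict)
    then have "\<not> lt (b (Suc n)) (c (Suc n))" "\<not> lt (c (Suc n)) (b (Suc n))"
      using Suc.prems(2)[of i "Suc n"] Suc.prems(3)[of j "Suc n"] i j by auto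
    then show False using total neq by blast
  qed
  then have "image_mset b (mset_set {1..n}) = image_mset c (mset_set {1..n})"
    using Suc.prems(1) unfolding ins by simp
  then have "\<forall>i\<in>{1..n}. b i = c i"
    by (rule Suc.IH) (use Suc.prems(2,3) in auto)
  then show ?case using top unfolding ins by blast
qed simp

lemma less_fun_total_nat:
  fixes x y :: "nat \<Rightarrow> 'a::linorder"
  assumes "x \<noteq> y"
  shows "less_fun x y \<or> less_fun y x"
proof -
  define k where "k = (LEAST k. x k \<noteq> y k)"
  have "\<exists>k. x k \<noteq> y k" using assms by auto
  then have "x k \<noteq> y k" unfolding k_def by (rule LeastI_ex)
  moreover have "x k' = y k'" if "k' < k" for k'
    using not_less_Least[of k' "\<lambda>k. x k \<noteq> y k"] that unfolding k_def by blast
  ultimately show ?thesis unfolding less_fun_def by (metis linorder_neqE)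
qed

text \<open>Grouped by orbits, an orbit of size \<open>c\<close> contributes \<open>c\<close> terms
  \<open>1 / c\<close>. This matches the definition of \<open>necklace_count\<close>.\<close>

lemma sum_inverse_card_orbit:
  assumes \<sigma>: "\<sigma> permutes {1..n}"
  shows "(\<Sum>i\<in>{1..n}. 1 / real (card (orbit \<sigma> i))) = real (num_cycles n \<sigma>)"
proof -
  have perm: "permutation \<sigma>" using \<sigma> by (auto simp: permutation_permutes)
  define T where "T = {C. C \<subseteq> {1..n} \<and> cyclic_on \<sigma> C}"
  have finT: "finite T" by (rule finite_subset[of _ "Pow {1..n}"]) (auto simp: T_def)
  have sub: "orbit \<sigma> i \<subseteq> {1..n}" if "i \<in> {1..n}" for i
    using permutes_orbit_subset[OF \<sigma> that] .
  have "(\<Sum>i\<in>{1..n}. 1 / real (card (orbit \<sigma> i)))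
      = (\<Sum>C\<in>T. \<Sum>i\<in>{i\<in>{1..n}. orbit \<sigma> i = C}. 1 / real (card (orbit \<sigma> i)))"
  proof (rule sum.group[symmetric, OF _ finT])
    show "orbit \<sigma> ` {1..n} \<subseteq> T"
      unfolding T_def cyclic_on_def using sub permutation_self_in_orbit[OF perm] by blast
  qed simp
  also have "\<dots> = (\<Sum>C\<in>T. 1)"
  proof (rule sum.cong[OF refl])
    fix C assume C: "C \<in> T"
    then have orb: "C \<noteq> {}" "\<And>i. i \<in> C \<Longrightarrow> orbit \<sigma> i = C" "C \<subseteq> {1..n}"
      by (auto simp: T_def cyclic_on_alldef)
    then have "{i\<in>{1..n}. orbit \<sigma> i = C} = C"
      using permutation_self_in_orbit[OF perm] by blast
    moreover have "finite C" using orb(3) by (rule finite_subset) simp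
    ultimately show "(\<Sum>i\<in>{i\<in>{1..n}. orbit \<sigma> i = C}. 1 / real (card (orbit \<sigma> i))) = 1"
      using orb by simp
  qed
  finally show ?thesis by (simp add: num_cycles_def T_def)
qed

context
  fixes n :: nat and g :: "nat \<Rightarrow> real" and \<sigma> \<tau> :: "nat \<Rightarrow> nat" and B :: "nat \<Rightarrow> nat \<Rightarrow> real"
  defines "\<sigma> \<equiv> standardize n g" and "\<tau> \<equiv> inv \<sigma>"
    and "B \<equiv> \<lambda>i t. g ((\<tau> ^^ Suc t) i)"
begin

lemma standardize_permutes: "\<sigma> permutes {1..n}"
  using is_standardization_standardize[of n g] by (simp add: \<sigma>_def is_standardization_def)

lemma inv_standardize_permutes: "\<tau> permutes {1..n}"
  unfolding \<tau>_def by (rule permutes_inv[OF standardize_permutes])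

text \<open>As \<open>i\<close> is the rank of position \<open>\<tau> i\<close>, the letters
  \<open>g (\<tau> i)\<close> come in sorted order. This is why the backward word \<open>B i\<close>
  starts with \<open>g (\<tau> i)\<close> and not with \<open>g i\<close>.\<close>

lemma inv_standardize_less_iff:
  assumes "i \<in> {1..n}" "j \<in> {1..n}"
  shows "i < j \<longleftrightarrow> g (\<tau> i) < g (\<tau> j) \<or> (g (\<tau> i) = g (\<tau> j) \<and> \<tau> i < \<tau> j)"
proof -
  have "\<tau> i \<in> {1..n}" "\<tau> j \<in> {1..n}"
    using assms permutes_in_image[OF inv_standardize_permutes] by blast+
  moreover have "\<sigma> (\<tau> i) = i" "\<sigma> (\<tau> j) = j"
    unfolding \<tau>_def using permutes_inverses(1)[OF standardize_permutes] by auto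
  ultimately show ?thesis
    using is_standardization_standardize[of n g] unfolding is_standardization_def \<sigma>_def[symmetric]
    by metis
qed

lemma funpow_inv_standardize_in:
  assumes "i \<in> {1..n}"
  shows "(\<tau> ^^ t) i \<in> {1..n}"
  by (induction t) (use assms permutes_in_image[OF inv_standardize_permutes] in auto)

lemma word_shift_backward_word: "(word_shift ^^ k) (B i) = B ((\<tau> ^^ k) i)"
proof
  fix t
  have "(\<tau> ^^ Suc (k + t)) i = (\<tau> ^^ Suc t) ((\<tau> ^^ k) i)"
    by (metis add_Suc_right add.commute comp_apply funpow_add)
  then show "(word_shift ^^ k) (B i) t = B ((\<tau> ^^ k) i) t"
    by (simp only: word_shift_funpow B_def)
qed

text \<open>Between equal letters standardization compares positions, so each common letter of the
  two words hands the comparison on to the next power of \<open>\<tau>\<close>.\<close>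

lemma backward_word_less_iff:
  assumes "i \<in> {1..n}" "j \<in> {1..n}" "\<And>s. s < t \<Longrightarrow> B i s = B j s"
  shows "i < j \<longleftrightarrow> (\<tau> ^^ t) i < (\<tau> ^^ t) j"
  using assms(3)
proof (induction t)
  case (Suc t)
  have "B i t = B j t" using Suc.prems by simp
  then have "g (\<tau> ((\<tau> ^^ t) i)) = g (\<tau> ((\<tau> ^^ t) j))" by (simp add: B_def)
  then have "(\<tau> ^^ t) i < (\<tau> ^^ t) j \<longleftrightarrow> (\<tau> ^^ Suc t) i < (\<tau> ^^ Suc t) j"
    using inv_standardize_less_iff[OF funpow_inv_standardize_in[OF assms(1)] funpow_inv_standardize_in[OF assms(2)], of t t]
    by simp
  then show ?case using Suc by simp
qed simp

text \<open>At the first letter where the words differ, the positions reached are still in the order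
  of \<open>i\<close> and \<open>j\<close>, and their next letters are sorted accordingly.\<close>

lemma backward_words_sorted:
  assumes "i \<in> {1..n}" "j \<in> {1..n}" "i < j"
  shows "\<not> less_fun (B j) (B i)"
proof
  assume "less_fun (B j) (B i)"
  then obtain t where t: "B j t < B i t" "\<And>s. s < t \<Longrightarrow> B j s = B i s" by (auto elim: less_funE)
  then have "(\<tau> ^^ t) i < (\<tau> ^^ t) j" using backward_word_less_iff[OF assms(1,2), of t] assms(3) by simp
  then have "g (\<tau> ((\<tau> ^^ t) i)) \<le> g (\<tau> ((\<tau> ^^ t) j))"
    using inv_standardize_less_iff[OF funpow_inv_standardize_in[OF assms(1)] funpow_inv_standardize_in[OF assms(2)], of t t]
    by auto
  then show False using t(1) by (simp add: B_def)
qed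

text \<open>If a power of \<open>\<tau>\<close> fixed the backward word of \<open>i\<close> but moved \<open>i\<close>, it would move \<open>i\<close>
  monotonically forever, as it preserves the order of positions with equal backward words.\<close>

lemma backward_word_period_iff:
  assumes i: "i \<in> {1..n}"
  shows "(word_shift ^^ k) (B i) = B i \<longleftrightarrow> (\<tau> ^^ k) i = i"
proof
  assume eq: "(word_shift ^^ k) (B i) = B i"
  define c where "c m = (\<tau> ^^ (k * m)) i" for m
  have c_in: "c m \<in> {1..n}" for m unfolding c_def by (rule funpow_inv_standardize_in[OF i])
  have c_Suc: "c (Suc m) = (\<tau> ^^ k) (c m)" for m
    by (simp add: c_def funpow_add)
  have Bc: "B (c m) = B i" for m
  proof (induction m)
    case (Suc m)
    have "B (c (Suc m)) = (word_shift ^^ k) (B (c m))"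
      by (simp add: c_Suc word_shift_backward_word)
    then show ?case using Suc eq by simp
  qed (simp add: c_def)
  have step: "c m < c l \<longleftrightarrow> c (Suc m) < c (Suc l)" for m l
    unfolding c_Suc by (rule backward_word_less_iff) (use c_in Bc in auto)
  have up: "c m < c (Suc m) \<longleftrightarrow> c 0 < c 1" for m
    by (induction m) (use step in auto)
  have down: "c (Suc m) < c m \<longleftrightarrow> c 1 < c 0" for m
    by (induction m) (use step in auto)
  have "permutation \<tau>" using inv_standardize_permutes by (auto simp: permutation_permutes)
  \<comment> \<open>Since \<open>\<tau>\<close> has finite order, the sequence \<open>c\<close>
    returns to its start, which excludes a strictly monotone drift.\<close>
  then obtain N where N: "\<tau> ^^ N = id" "N > 0" using permutation_is_nilpotent by blast
  have "c N = ((\<tau> ^^ N) ^^ k) i" by (simp add: c_def funpow_mult mult.commute)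
  then have cN: "c N = c 0" using N by (simp add: c_def)
  have "c 0 = c 1"
  proof (rule ccontr)
    assume "c 0 \<noteq> c 1"
    then consider "c 0 < c 1" | "c 1 < c 0" by linarith
    then show False
    proof cases
      case 1
      have "c 0 < c m" if "0 < m" for m
        using that
      proof (induction m rule: nat_induct_non_zero)
        case (Suc m)
        then show ?case using up[of m] 1 by linarith
      qed (use 1 in simp)
      from this[OF N(2)] show False using cN by simp
    next
      case 2
      have "c m < c 0" if "0 < m" for m
        using that
      proof (induction m rule: nat_induct_non_zero)
        case (Suc m)
        then show ?case using down[of m] 2 by linarith
      qed (use 2 in simp)
      from this[OF N(2)] show False using cN by simp
    qed
  qed
  then show "(\<tau> ^^ k) i = i" by (simp add: c_def)
qed (simp add: word_shift_backward_word)

text \<open>The shift powers fixing \<open>B i\<close> are the powers of \<open>\<tau>\<close>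
  fixing \<open>i\<close>, and a permutation has the same orbits as its inverse.\<close>

lemma period_backward_word:
  assumes i: "i \<in> {1..n}"
  shows "period (B i) = card (orbit \<sigma> i)"
proof -
  have perm: "permutation \<tau>" using inv_standardize_permutes by (auto simp: permutation_permutes)
  then obtain N where N: "(\<tau> ^^ N) i = i" "0 < N" using permutation_is_nilpotent by (metis id_apply)
  have "period (B i) = least_power \<tau> i"
    unfolding least_power_def backward_word_period_iff[OF i] ..
  also have "\<dots> = card ((\<lambda>t. (\<tau> ^^ t) i) ` {..<least_power \<tau> i})"
    using inj_on_funpow_least_power[OF N(2,1)] by (simp add: card_image)
  also have "(\<lambda>t. (\<tau> ^^ t) i) ` {..<least_power \<tau> i} = orbit \<tau> i"
    using orbit_altdef_bounded[of "least_power \<tau> i" \<tau> i] least_power_of_permutation[OF perm, of i] by auto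
  also have "orbit \<tau> i = orbit \<sigma> i"
    unfolding \<tau>_def using standardize_permutes
    by (intro orbit_inv_eq) (auto simp: permutation_permutes)
  finally show ?thesis .
qed

lemma image_mset_permutes:
  assumes "\<pi> permutes {1..n}"
  shows "image_mset \<pi> (mset_set {1..n}) = mset_set {1..n}"
  using assms by (simp add: image_mset_mset_set permutes_inj_on permutes_image)

definition backward_words :: "(nat \<Rightarrow> real) multiset" where
  "backward_words = image_mset B (mset_set {1..n})"

lemma backward_words_in_necklace_msets:
  assumes "\<And>i. i \<in> {1..n} \<Longrightarrow> g i \<in> I"
  shows "backward_words \<in> necklace_msets I n"
proof -
  have "word_shift (B i) = B (\<tau> i)" for i using word_shift_backward_word[of 1 i] by simp
  then have "image_mset word_shift backward_words = image_mset B (image_mset \<tau> (mset_set {1..n}))"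
    by (simp add: backward_words_def image_mset.compositionality comp_def)
  also have "\<dots> = backward_words"
    by (simp only: image_mset_permutes[OF inv_standardize_permutes] backward_words_def)
  finally have "image_mset word_shift backward_words = backward_words" .
  moreover have "range (B i) \<subseteq> I" if "i \<in> {1..n}" for i
    using assms funpow_inv_standardize_in[OF that] unfolding B_def by blast
  ultimately show ?thesis by (auto simp: necklace_msets_def backward_words_def)
qed

lemma mset_weight_backward_words: "mset_weight p backward_words = (\<Prod>i=1..n. p (g i))"
proof -
  have "mset_weight p backward_words = (\<Prod>x\<in>#image_mset \<tau> (mset_set {1..n}). p (g x))"
    by (simp add: mset_weight_def backward_words_def B_def image_mset.compositionality comp_def)
  then show ?thesis
    by (simp only: image_mset_permutes[OF inv_standardize_permutes] prod_unfold_prod_mset)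
qed

lemma necklace_count_backward_words: "necklace_count backward_words = real (num_cycles n \<sigma>)"
proof -
  have "necklace_count backward_words = (\<Sum>i=1..n. 1 / real (period (B i)))"
    by (simp add: necklace_count_def backward_words_def image_mset.compositionality comp_def
        sum_unfold_sum_mset)
  also have "\<dots> = (\<Sum>i=1..n. 1 / real (card (orbit \<sigma> i)))"
    by (intro sum.cong) (simp_all add: period_backward_word)
  finally show ?thesis using sum_inverse_card_orbit[OF standardize_permutes] by simp
qed

text \<open>The witness \<open>B (\<sigma> i)\<close> is \<open>B i\<close> with the letter
  \<open>g i\<close> put in front; it allows \<open>g i\<close> to be read off from the
  multiset.\<close>

lemma backward_words_nth:
  assumes "i \<in> {1..n}"
  obtains y where "y \<in># backward_words" "word_shift y = B i" "y 0 = g i"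
proof (rule that[of "B (\<sigma> i)"])
  have "\<tau> (\<sigma> i) = i" unfolding \<tau>_def using permutes_inverses(2)[OF standardize_permutes] by auto
  then show "word_shift (B (\<sigma> i)) = B i" "B (\<sigma> i) 0 = g i"
    using word_shift_backward_word[of 1 "\<sigma> i"] by (auto simp: B_def)
  show "B (\<sigma> i) \<in># backward_words"
    using assms permutes_in_image[OF standardize_permutes, of i] by (auto simp: backward_words_def)
qed

end

text \<open>Sorting the multiset recovers every \<open>B i\<close>. The letter \<open>g i\<close> is
  then the one that can precede \<open>B i\<close> inside the multiset, and it is unique because the
  shift is injective on the support.\<close>

lemma backward_words_inj:
  assumes eq: "backward_words n g = backward_words n h" and i: "i \<in> {1..n}"
  shows "g i = h i"
proof -
  let ?B = "\<lambda>g i t. g ((inv (standardize n g) ^^ Suc t) i)"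
  have "\<forall>i\<in>{1..n}. ?B g i = ?B h i"
    by (rule image_mset_sorted_eq[where lt = less_fun])
       (use eq less_fun_total_nat backward_words_sorted in \<open>auto simp: backward_words_def\<close>)
  then have Bi: "?B g i = ?B h i" using i by blast
  obtain y where y: "y \<in># backward_words n g" "word_shift y = ?B g i" "y 0 = g i"
    using backward_words_nth[OF i] by blast
  obtain z where z: "z \<in># backward_words n h" "word_shift z = ?B h i" "z 0 = h i"
    using backward_words_nth[OF i] by blast
  \<comment> \<open>Taking all reals as alphabet makes the condition on letters trivial and leaves
    the shift invariance.\<close>
  have "image_mset word_shift (backward_words n g) = backward_words n g"
    using backward_words_in_necklace_msets[of n g UNIV] by (simp add: necklace_msets_def)
  then have "inj_on word_shift (set_mset (backward_words n g))" by (rule invariant_mset_inj_on)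
  moreover have "word_shift y = word_shift z" using y(2) z(2) Bi by simp
  ultimately have "y = z" using y(1) z(1) eq by (simp add: inj_on_def)
  then show ?thesis using y z by simp
qed

lemma standardize_cong:
  assumes less: "\<And>i j. i \<in> {1..n} \<Longrightarrow> j \<in> {1..n} \<Longrightarrow> g i < g j \<longleftrightarrow> h i < h j"
  shows "standardize n g = standardize n h"
proof -
  have eq: "g i = g j \<longleftrightarrow> h i = h j" if "i \<in> {1..n}" "j \<in> {1..n}" for i j
    using less[OF that] less[OF that(2,1)] by (metis less_irrefl linorder_neqE)
  have "is_standardization n g = is_standardization n h"
    unfolding is_standardization_def using less eq by (intro ext conj_cong ball_cong refl) simp
  then show ?thesis by (simp add: standardize_def)
qed

text \<open>Backward words embed the words into the necklace multisets with weight and cycle count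
  preserved. Surjectivity is obtained up to multisets of weight 0, which do not affect the
  sum.\<close>

lemma cycle_gf_has_sum:
  assumes "letter_distribution I p R"
  shows "((\<lambda>g. of_real (\<Prod>i=1..n. p (g i)) * exp (of_nat (num_cycles n (standardize n g)) * z))
     has_sum letter_distribution.mset_gf I p n z) (PiE {1..n} (\<lambda>_. I))"
proof -
  interpret letter_distribution I p R by (rule assms)
  let ?W = "PiE {1..n} (\<lambda>_. I)"
  have sub: "backward_words n ` ?W \<subseteq> necklace_msets I n"
    using backward_words_in_necklace_msets by (auto simp: PiE_iff)
  have inj: "inj_on (backward_words n) ?W"
    by (intro inj_onI PiE_ext[where k = "{1..n}" and s = "\<lambda>_. I"]) (use backward_words_inj in blast)+
  have nonneg: "0 \<le> mset_weight p X" if "X \<in> necklace_msets I n" for X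
  proof -
    have "\<forall>x\<in>#X. 0 \<le> p (x 0)" using that prob_nonneg unfolding necklace_msets_def by blast
    then show ?thesis unfolding mset_weight_def by (induction X) auto
  qed
  have "((\<lambda>g. mset_weight p (backward_words n g)) has_sum 1) ?W"
    unfolding mset_weight_backward_words by (rule prod_prob_has_sum) simp
  then have sum1: "(mset_weight p has_sum 1) (backward_words n ` ?W)"
    using has_sum_reindex[OF inj, of "mset_weight p" 1] by (simp add: comp_def)
  \<comment> \<open>The image already carries mass 1, the total mass, so any further multiset of
    positive weight would exceed it.\<close>
  have zero: "mset_weight p X = 0" if X: "X \<in> necklace_msets I n - backward_words n ` ?W" for X
  proof -
    have "(mset_weight p has_sum 1 + mset_weight p X) (backward_words n ` ?W \<union> {X})"
      using X by (intro has_sum_Un_disjoint sum1 has_sum_finiteI) auto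
    then have "1 + mset_weight p X \<le> 1"
      by (rule has_sum_mono2[OF _ mset_weight_has_sum[of n]]) (use X sub nonneg in auto)
    then show ?thesis using nonneg[of X] X by simp
  qed
  have "(mset_term z has_sum mset_gf n z) (necklace_msets I n)"
    unfolding mset_gf_def
    by (rule has_sum_infsum[OF Infinite_Sum.abs_summable_summable[OF mset_term_abs_summable]])
  also have "?this \<longleftrightarrow> (mset_term z has_sum mset_gf n z) (backward_words n ` ?W)"
    by (rule has_sum_cong_neutral) (use zero sub in \<open>auto simp: mset_term_def\<close>)
  also have "\<dots> \<longleftrightarrow> ((mset_term z \<circ> backward_words n) has_sum mset_gf n z) ?W"
    by (rule has_sum_reindex[OF inj])
  finally show ?thesis
    by (simp add: comp_def mset_term_def mset_weight_backward_words necklace_count_backward_words)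
qed

subsection \<open>Cycle counts of random words\<close>

lemma num_cycles_le:
  assumes "\<sigma> permutes {1..n}"
  shows "num_cycles n \<sigma> \<le> n"
proof -
  have "real (num_cycles n \<sigma>) = (\<Sum>i\<in>{1..n}. 1 / real (card (orbit \<sigma> i)))"
    by (rule sum_inverse_card_orbit[OF assms, symmetric])
  also have "\<dots> \<le> (\<Sum>i\<in>{1..n}. 1)"
    by (intro sum_mono) (auto simp: divide_le_eq_1 Suc_le_eq)
  finally show ?thesis by simp
qed

lemma num_cycles_standardize_le: "num_cycles n (standardize n g) \<le> n"
  by (rule num_cycles_le[OF standardize_permutes])

text \<open>The cycle count depends on the letters only through the finite relation
  \<open>g j < g k\<close>, and each value of this relation is attained on a measurable
  event.\<close>

lemma measurable_num_cycles_standardize: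
  fixes X :: "nat \<Rightarrow> 'a \<Rightarrow> real"
  assumes X: "\<And>j. j \<in> {1..n} \<Longrightarrow> X j \<in> borel_measurable M"
  shows "(\<lambda>\<omega>. num_cycles n (standardize n (\<lambda>j. X j \<omega>))) \<in> measurable M (count_space UNIV)"
proof -
  define rel where "rel g = {(j, k). j \<in> {1..n} \<and> k \<in> {1..n} \<and> g j < g k}" for g :: "nat \<Rightarrow> real"
  \<comment> \<open>Any word inducing the relation \<open>r\<close> serves as representative; the
    value at relations induced by no word is arbitrary.\<close>
  define cyc where "cyc r = num_cycles n (standardize n (SOME g. rel g = r))" for r
  have "num_cycles n (standardize n g) = cyc (rel g)" for g
  proof -
    have "rel (SOME h. rel h = rel g) = rel g" by (rule someI[of _ g]) simp
    then have "standardize n (SOME h. rel h = rel g) = standardize n g"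
      by (intro standardize_cong) (auto simp: rel_def set_eq_iff)
    then show ?thesis by (simp add: cyc_def)
  qed
  moreover have "(\<lambda>\<omega>. rel (\<lambda>j. X j \<omega>)) \<in> measurable M (count_space (Pow ({1..n} \<times> {1..n})))"
    unfolding measurable_count_space_eq2[OF finite_Pow_iff[THEN iffD2, OF finite_cartesian_product[OF finite_atLeastAtMost finite_atLeastAtMost]]]
  proof (intro conjI ballI)
    show "(\<lambda>\<omega>. rel (\<lambda>j. X j \<omega>)) \<in> space M \<rightarrow> Pow ({1..n} \<times> {1..n})"
      by (auto simp: rel_def)
    fix r assume r: "r \<in> Pow ({1..n} \<times> {1..n})"
    have rel_eq: "rel g = r \<longleftrightarrow> (\<forall>j\<in>{1..n}. \<forall>k\<in>{1..n}. g j < g k \<longleftrightarrow> (j, k) \<in> r)" for g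
    proof
      assume *: "rel g = r"
      show "\<forall>j\<in>{1..n}. \<forall>k\<in>{1..n}. g j < g k \<longleftrightarrow> (j, k) \<in> r"
        unfolding *[symmetric] rel_def by auto
    qed (use r in \<open>auto simp: rel_def\<close>)
    have "(\<lambda>\<omega>. rel (\<lambda>j. X j \<omega>)) -` {r} \<inter> space M
        = {\<omega> \<in> space M. \<forall>j\<in>{1..n}. \<forall>k\<in>{1..n}. X j \<omega> < X k \<omega> \<longleftrightarrow> (j, k) \<in> r}"
      by (intro set_eqI) (simp add: rel_eq conj_commute)
    also have "\<dots> \<in> sets M"
      using X by measurable
    finally show "(\<lambda>\<omega>. rel (\<lambda>j. X j \<omega>)) -` {r} \<inter> space M \<in> sets M" .
  qed
  ultimately show ?thesis
    by (auto intro: measurable_compose[of _ _ _ cyc])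
qed

text \<open>The variables may leave \<open>I\<close> on a null set. A finite partial sum over
  \<open>F\<close> therefore differs from the expectation by at most \<open>C\<close> times the mass
  missed by \<open>F\<close>, and this mass tends to 0 because the word weights sum to 1.\<close>

lemma expectation_discrete_vector:
  fixes X :: "nat \<Rightarrow> 'a \<Rightarrow> real" and h :: "(nat \<Rightarrow> real) \<Rightarrow> complex"
  assumes M: "prob_space M" and indep: "prob_space.indep_vars M (\<lambda>_. borel) X {1..n}" and n: "1 \<le> n"
    and p: "\<And>j i. j \<in> {1..n} \<Longrightarrow> i \<in> I \<Longrightarrow> measure M {\<omega> \<in> space M. X j \<omega> = i} = p i"
    and ld: "letter_distribution I p R"
    and h_bounded: "\<And>g. norm (h g) \<le> C"
    and h_meas: "(\<lambda>\<omega>. h (\<lambda>j. X j \<omega>)) \<in> borel_measurable M"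
    and h_cong: "\<And>g g'. (\<And>j. j \<in> {1..n} \<Longrightarrow> g j = g' j) \<Longrightarrow> h g = h g'"
  shows "((\<lambda>g. of_real (\<Prod>i=1..n. p (g i)) * h g) has_sum (\<integral>\<omega>. h (\<lambda>j. X j \<omega>) \<partial>M)) (PiE {1..n} (\<lambda>_. I))"
proof -
  interpret prob_space M by (rule M)
  interpret letter_distribution I p R by (rule ld)
  define w where "w g = (\<Prod>i=1..n. p (g i))" for g
  let ?W = "PiE {1..n} (\<lambda>_. I)"
  define A where "A g = {\<omega> \<in> space M. \<forall>j\<in>{1..n}. X j \<omega> = g j}" for g
  have X: "X j \<in> borel_measurable M" if "j \<in> {1..n}" for j
    using indep that unfolding indep_vars_def by auto
  have A_sets: "A g \<in> sets M" for g
    unfolding A_def using X by measurable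
  have A_prob: "prob (A g) = w g" if "g \<in> ?W" for g
  proof -
    have "A g = (\<Inter>j\<in>{1..n}. X j -` {g j} \<inter> space M)" using n by (auto simp: A_def)
    also have "prob \<dots> = (\<Prod>j=1..n. prob (X j -` {g j} \<inter> space M))"
      using n by (intro indep_varsD_finite[OF indep]) auto
    also have "\<dots> = w g"
      unfolding w_def
    proof (rule prod.cong[OF refl])
      fix j assume j: "j \<in> {1..n}"
      have "X j -` {g j} \<inter> space M = {\<omega> \<in> space M. X j \<omega> = g j}" by auto
      then show "prob (X j -` {g j} \<inter> space M) = p (g j)" using p[OF j] PiE_mem[OF that j] by simp
    qed
    finally show ?thesis .
  qed
  have h_int: "integrable M (\<lambda>\<omega>. h (\<lambda>j. X j \<omega>))"
    using h_bounded h_meas by (intro integrable_const_bound[of _ C]) auto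
  have bound: "norm ((\<Sum>g\<in>F. of_real (w g) * h g) - (\<integral>\<omega>. h (\<lambda>j. X j \<omega>) \<partial>M)) \<le> C * (1 - (\<Sum>g\<in>F. w g))"
    if F: "finite F" "F \<subseteq> ?W" for F
  proof -
    \<comment> \<open>The indicator of the event that the random word is none of the words in
      \<open>F\<close>; the events \<open>A g\<close> are disjoint for distinct \<open>g\<close> in
      \<open>F\<close>.\<close>
    define D where "D \<omega> = 1 - (\<Sum>g\<in>F. indicator (A g) \<omega> :: real)" for \<omega>
    have D_nonneg: "0 \<le> D \<omega>" for \<omega>
    proof -
      have "g = g'" if "g \<in> F" "g' \<in> F" "\<omega> \<in> A g" "\<omega> \<in> A g'" for g g'
        using that F by (intro PiE_ext[where k = "{1..n}" and s = "\<lambda>_. I"]) (auto simp: A_def)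
      then have "card {g\<in>F. \<omega> \<in> A g} \<le> 1"
        using F by (subst card_le_Suc0_iff_eq[unfolded One_nat_def[symmetric]]) auto
      moreover have "(\<Sum>g\<in>F. indicator (A g) \<omega> :: real) = card {g\<in>F. \<omega> \<in> A g}"
        using F by (simp add: indicator_def sum.If_cases Int_def)
      ultimately show ?thesis by (simp add: D_def)
    qed
    have ind_int: "integrable M (indicator (A g) :: 'a \<Rightarrow> real)" for g
      using A_sets by (simp add: emeasure_eq_measure)
    have D_int: "integrable M D" unfolding D_def using ind_int by auto
    have "(\<integral>\<omega>. D \<omega> \<partial>M) = 1 - (\<Sum>g\<in>F. w g)"
      unfolding D_def using ind_int A_sets F
      by (subst Bochner_Integration.integral_diff)
         (auto simp: prob_space Bochner_Integration.integral_sum A_prob subset_iff intro!: sum.cong)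
    \<comment> \<open>On \<open>A g\<close> the random word agrees with \<open>g\<close> on
      \<open>{1..n}\<close>, so \<open>h\<close> takes the value \<open>h g\<close> there by
      \<open>h_cong\<close>.\<close>
    have pw: "h (\<lambda>j. X j \<omega>) - (\<Sum>g\<in>F. indicator (A g) \<omega> *\<^sub>R h g) = D \<omega> *\<^sub>R h (\<lambda>j. X j \<omega>)" for \<omega>
    proof -
      have "indicator (A g) \<omega> *\<^sub>R h g = indicator (A g) \<omega> *\<^sub>R h (\<lambda>j. X j \<omega>)" for g
        using h_cong[of g "\<lambda>j. X j \<omega>"] by (auto simp: A_def indicator_def)
      then have "(\<Sum>g\<in>F. indicator (A g) \<omega> *\<^sub>R h g) = (\<Sum>g\<in>F. indicator (A g) \<omega> *\<^sub>R h (\<lambda>j. X j \<omega>))"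
        by (intro sum.cong refl)
      then show ?thesis by (simp only: D_def scaleR_diff_left scaleR_sum_left scaleR_one)
    qed
    have "(\<integral>\<omega>. h (\<lambda>j. X j \<omega>) \<partial>M) - (\<Sum>g\<in>F. of_real (w g) * h g)
        = (\<integral>\<omega>. h (\<lambda>j. X j \<omega>) - (\<Sum>g\<in>F. indicator (A g) \<omega> *\<^sub>R h g) \<partial>M)"
      using h_int ind_int A_sets F
      by (subst Bochner_Integration.integral_diff)
         (auto simp: Bochner_Integration.integral_sum A_prob subset_iff scaleR_conv_of_real intro!: sum.cong)
    also have "\<dots> = (\<integral>\<omega>. D \<omega> *\<^sub>R h (\<lambda>j. X j \<omega>) \<partial>M)" by (simp only: pw)
    also have "norm \<dots> \<le> (\<integral>\<omega>. C * D \<omega> \<partial>M)"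
    proof (rule order.trans[OF Bochner_Integration.integral_norm_bound integral_mono])
      have "integrable M (\<lambda>\<omega>. D \<omega> *\<^sub>R h (\<lambda>j. X j \<omega>))"
        unfolding pw[symmetric] using h_int ind_int by auto
      then show "integrable M (\<lambda>\<omega>. norm (D \<omega> *\<^sub>R h (\<lambda>j. X j \<omega>)))" by (rule integrable_norm)
      show "integrable M (\<lambda>\<omega>. C * D \<omega>)" using D_int by simp
      show "norm (D \<omega> *\<^sub>R h (\<lambda>j. X j \<omega>)) \<le> C * D \<omega>" for \<omega>
        using mult_left_mono[OF h_bounded D_nonneg] by (simp add: D_nonneg mult.commute)
    qed
    also have "\<dots> = C * (1 - (\<Sum>g\<in>F. w g))" using \<open>(\<integral>\<omega>. D \<omega> \<partial>M) = _\<close> by simp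
    finally show ?thesis by (simp add: norm_minus_commute)
  qed
  have "(w has_sum 1) ?W" unfolding w_def by (rule prod_prob_has_sum) simp
  then have "(sum w \<longlongrightarrow> 1) (finite_subsets_at_top ?W)" by (simp add: has_sum_def)
  then have "((\<lambda>F. C * (1 - sum w F)) \<longlongrightarrow> C * (1 - 1)) (finite_subsets_at_top ?W)"
    by (intro tendsto_intros)
  then have lim: "((\<lambda>F. C * (1 - sum w F)) \<longlongrightarrow> 0) (finite_subsets_at_top ?W)" by simp
  have "((\<lambda>F. (\<Sum>g\<in>F. of_real (w g) * h g) - (\<integral>\<omega>. h (\<lambda>j. X j \<omega>) \<partial>M)) \<longlongrightarrow> 0) (finite_subsets_at_top ?W)"
    by (rule Lim_null_comparison[OF _ lim])
       (intro eventually_finite_subsets_at_top_weakI bound)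
  then show ?thesis
    unfolding has_sum_def w_def by (rule LIM_zero_cancel)
qed

lemma expectation_exp_num_cycles:
  fixes X :: "nat \<Rightarrow> 'a \<Rightarrow> real"
  assumes M: "prob_space M" and indep: "prob_space.indep_vars M (\<lambda>_. borel) X {1..n}" and n: "1 \<le> n"
    and p: "\<And>j i. j \<in> {1..n} \<Longrightarrow> i \<in> I \<Longrightarrow> measure M {\<omega> \<in> space M. X j \<omega> = i} = p i"
    and ld: "letter_distribution I p R"
  shows "(\<integral>\<omega>. exp (of_nat (num_cycles n (standardize n (\<lambda>j. X j \<omega>))) * z) \<partial>M)
    = letter_distribution.mset_gf I p n z"
proof -
  interpret prob_space M by (rule M)
  have X: "X j \<in> borel_measurable M" if "j \<in> {1..n}" for j
    using indep that unfolding indep_vars_def by auto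
  have "((\<lambda>g. of_real (\<Prod>i=1..n. p (g i)) * exp (of_nat (num_cycles n (standardize n g)) * z))
      has_sum (\<integral>\<omega>. exp (of_nat (num_cycles n (standardize n (\<lambda>j. X j \<omega>))) * z) \<partial>M)) (PiE {1..n} (\<lambda>_. I))"
  proof (rule expectation_discrete_vector[OF M indep n p ld, where C = "exp (real n * norm z)"])
    show "norm (exp (of_nat (num_cycles n (standardize n g)) * z)) \<le> exp (real n * norm z)" for g
      using num_cycles_standardize_le[of n g]
      by (intro order.trans[OF norm_exp]) (simp add: norm_mult mult_right_mono)
    show "(\<lambda>\<omega>. exp (of_nat (num_cycles n (standardize n (\<lambda>j. X j \<omega>))) * z)) \<in> borel_measurable M"
      by (rule measurable_compose[OF measurable_num_cycles_standardize[OF X]]) simp_all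
    show "exp (of_nat (num_cycles n (standardize n g)) * z) = exp (of_nat (num_cycles n (standardize n g')) * z)"
      if "\<And>j. j \<in> {1..n} \<Longrightarrow> g j = g' j" for g g'
      using standardize_cong[of n g g'] that by simp
  qed
  with cycle_gf_has_sum[OF ld, of n z] show ?thesis by (rule has_sum_unique[symmetric])
qed

text \<open>Writing expectations as finite sums makes the moment generating function a finite
  exponential sum, which is entire and can be differentiated termwise.\<close>

lemma expectation_bounded_nat:
  fixes h :: "nat \<Rightarrow> 'b::{banach, second_countable_topology}"
  assumes M: "prob_space M" and K: "K \<in> measurable M (count_space UNIV)"
    and le: "\<And>\<omega>. K \<omega> \<le> (n::nat)"
  shows "(\<integral>\<omega>. h (K \<omega>) \<partial>M) = (\<Sum>l\<le>n. measure M (K -` {l} \<inter> space M) *\<^sub>R h l)"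
proof -
  interpret prob_space M by (rule M)
  have sets: "K -` {l} \<inter> space M \<in> sets M" for l using K by (rule measurable_sets) simp
  have "(\<integral>\<omega>. h (K \<omega>) \<partial>M) = (\<integral>\<omega>. (\<Sum>l\<le>n. indicator (K -` {l} \<inter> space M) \<omega> *\<^sub>R h l) \<partial>M)"
  proof (rule Bochner_Integration.integral_cong[OF refl])
    fix \<omega> assume "\<omega> \<in> space M"
    then have "(\<Sum>l\<le>n. indicator (K -` {l} \<inter> space M) \<omega> *\<^sub>R h l) = (\<Sum>l\<le>n. if K \<omega> = l then h l else 0)"
      by (intro sum.cong) (auto simp: indicator_def)
    then show "h (K \<omega>) = (\<Sum>l\<le>n. indicator (K -` {l} \<inter> space M) \<omega> *\<^sub>R h l)" using le[of \<omega>] by simp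
  qed
  also have "\<dots> = (\<Sum>l\<le>n. measure M (K -` {l} \<inter> space M) *\<^sub>R h l)"
    using sets by (subst Bochner_Integration.integral_sum) (auto simp: emeasure_eq_measure)
  finally show ?thesis .
qed

section \<open>Moments as derivatives of moment generating functions\<close>

lemma higher_deriv_exp_sum:
  fixes c \<zeta> :: "'b \<Rightarrow> complex"
  shows "(deriv ^^ r) (\<lambda>s. \<Sum>l\<in>A. c l * exp (s * \<zeta> l)) = (\<lambda>s. \<Sum>l\<in>A. c l * \<zeta> l ^ r * exp (s * \<zeta> l))"
proof (induction r)
  case (Suc r)
  show ?case
  proof
    fix s
    have "((\<lambda>s. \<Sum>l\<in>A. c l * \<zeta> l ^ r * exp (s * \<zeta> l)) has_field_derivative
        (\<Sum>l\<in>A. c l * \<zeta> l ^ Suc r * exp (s * \<zeta> l))) (at s)"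
      by (rule DERIV_sum) (auto intro!: derivative_eq_intros)
    then show "(deriv ^^ Suc r) (\<lambda>s. \<Sum>l\<in>A. c l * exp (s * \<zeta> l)) s
        = (\<Sum>l\<in>A. c l * \<zeta> l ^ Suc r * exp (s * \<zeta> l))"
      using Suc by (simp add: DERIV_imp_deriv)
  qed
qed simp

text \<open>Differentiate \<open>f' = s * f\<close> repeatedly: each derivative of the product adds
  one more copy of the lower-order term.\<close>

lemma higher_deriv_gaussian_gf:
  "(deriv ^^ Suc (Suc r)) (\<lambda>s. exp (s\<^sup>2 / 2)) s
     = s * (deriv ^^ Suc r) (\<lambda>s. exp (s\<^sup>2 / 2)) s + of_nat (Suc r) * (deriv ^^ r) (\<lambda>s. exp (s\<^sup>2 / 2)) (s::complex)"
proof (induction r arbitrary: s)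
  case 0
  have 1: "deriv (\<lambda>s. exp (s\<^sup>2 / 2)) = (\<lambda>s::complex. s * exp (s\<^sup>2 / 2))"
    by (rule ext, rule DERIV_imp_deriv) (auto intro!: derivative_eq_intros)
  show ?case
    by (simp add: 1, rule DERIV_imp_deriv) (auto intro!: derivative_eq_intros simp: power2_eq_square algebra_simps)
next
  case (Suc r)
  let ?f = "\<lambda>s::complex. exp (s\<^sup>2 / 2)"
  have d: "((deriv ^^ k) ?f has_field_derivative (deriv ^^ Suc k) ?f s) (at s)" for k s
  proof -
    have "(deriv ^^ k) ?f holomorphic_on UNIV"
      by (intro holomorphic_higher_deriv holomorphic_intros) auto
    then show ?thesis using holomorphic_derivI[of _ UNIV s] by simp
  qed
  have eq: "(deriv ^^ Suc (Suc r)) ?f = (\<lambda>s. s * (deriv ^^ Suc r) ?f s + of_nat (Suc r) * (deriv ^^ r) ?f s)"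
    using Suc by (intro ext)
  have "((\<lambda>s. s * (deriv ^^ Suc r) ?f s + of_nat (Suc r) * (deriv ^^ r) ?f s) has_field_derivative
      (1 * (deriv ^^ Suc r) ?f s + (deriv ^^ Suc (Suc r)) ?f s * s) + of_nat (Suc r) * (deriv ^^ Suc r) ?f s) (at s)"
    by (intro DERIV_add DERIV_mult DERIV_cmult DERIV_ident d)
  then have "deriv ((deriv ^^ Suc (Suc r)) ?f) s
      = (1 * (deriv ^^ Suc r) ?f s + (deriv ^^ Suc (Suc r)) ?f s * s) + of_nat (Suc r) * (deriv ^^ Suc r) ?f s"
    unfolding eq[symmetric] by (rule DERIV_imp_deriv)
  then have "(deriv ^^ Suc (Suc (Suc r))) ?f s
      = (1 * (deriv ^^ Suc r) ?f s + (deriv ^^ Suc (Suc r)) ?f s * s) + of_nat (Suc r) * (deriv ^^ Suc r) ?f s"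
    by (simp only: funpow.simps(2) comp_apply)
  then show ?case by (simp only: of_nat_Suc) (simp only: algebra_simps mult_1_left)
qed

text \<open>At \<open>s = 0\<close> the recursion becomes \<open>d (r + 2) = (r + 1) * d r\<close>,
  whose solution vanishes at odd indices and equals the known Gaussian moments at even ones.\<close>

lemma std_normal_moment_eq_higher_deriv:
  "(deriv ^^ r) (\<lambda>s. exp (s\<^sup>2 / 2)) 0 = complex_of_real (\<integral>x. x ^ r \<partial>std_normal_distribution)"
proof -
  let ?d = "\<lambda>r. (deriv ^^ r) (\<lambda>s. exp (s\<^sup>2 / 2)) (0::complex)"
  have rec: "?d (Suc (Suc r)) = of_nat (Suc r) * ?d r" for r
    by (subst higher_deriv_gaussian_gf) simp
  have "deriv (\<lambda>s. exp (s\<^sup>2 / 2)) (0::complex) = 0"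
    by (rule DERIV_imp_deriv) (auto intro!: derivative_eq_intros)
  then have d1: "?d 1 = 0" by simp
  have even: "?d (2 * k) = of_real (fact (2 * k) / (2 ^ k * fact k))" for k
  proof (induction k)
    case (Suc k)
    have "?d (2 * Suc k) = of_nat (Suc (2 * k)) * ?d (2 * k)" using rec[of "2 * k"] by simp
    also have "\<dots> = of_real (real (Suc (2 * k)) * (fact (2 * k) / (2 ^ k * fact k)))"
      using Suc by (simp only: of_real_mult of_real_of_nat_eq)
    also have "real (Suc (2 * k)) * (fact (2 * k) / (2 ^ k * fact k)) = fact (2 * Suc k) / (2 ^ Suc k * fact (Suc k))"
      by (simp add: divide_simps)
    finally show ?case .
  qed simp
  have odd: "?d (Suc (2 * k)) = 0" for k
  proof (induction k)
    case (Suc k)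
    then show ?case using rec[of "Suc (2 * k)"] by simp
  qed (use d1 in simp)
  show ?thesis
  proof (cases "even r")
    case True
    then obtain k where "r = 2 * k" by blast
    then show ?thesis using even[of k] std_normal_distribution_even_moments(1)[of k] by simp
  next
    case False
    then obtain k where "r = Suc (2 * k)" by (metis oddE Suc_eq_plus1)
    then show ?thesis using odd[of k] integral_std_normal_distribution_moment_odd[of r] by simp
  qed
qed

section \<open>Central limit theorem and convergence of moments\<close>

theorem theorem1p6:
  fixes I :: "real set"
    and p :: "nat \<Rightarrow> real \<Rightarrow> real"
    and R :: real
    and M :: "nat \<Rightarrow> 'a measure"
    and G :: "nat \<Rightarrow> nat \<Rightarrow> 'a \<Rightarrow> real"
    and K Z :: "nat \<Rightarrow> 'a \<Rightarrow> real"
  assumes "countable I"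
    and "\<And>n i. n \<ge> 1 \<Longrightarrow> i \<in> I \<Longrightarrow> 0 \<le> p n i"
    and "\<And>n. n \<ge> 1 \<Longrightarrow> (p n has_sum 1) I"
    and "\<And>n. n \<ge> 1 \<Longrightarrow> prob_space (M n)"
    and "\<And>n. n \<ge> 1 \<Longrightarrow> prob_space.indep_vars (M n) (\<lambda>_. borel) (G n) {1..n}"
    and "\<And>n j i. n \<ge> 1 \<Longrightarrow> j \<in> {1..n} \<Longrightarrow> i \<in> I \<Longrightarrow>
           measure (M n) {\<omega> \<in> space (M n). G n j \<omega> = i} = p n i"
    and "0 < R" "R < 1"
    and "\<And>n i. n \<ge> 1 \<Longrightarrow> i \<in> I \<Longrightarrow> p n i \<le> R"
  defines "K \<equiv> \<lambda>n \<omega>. real (num_cycles n (standardize n (\<lambda>j. G n j \<omega>)))"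
    and "Z \<equiv> \<lambda>n \<omega>. (K n \<omega> - ln (real n)) / sqrt (ln (real n))"
  shows "weak_conv_m (\<lambda>n. distr (M n) borel (Z n)) std_normal_distribution \<and>
    (\<forall>r\<ge>1. (\<lambda>n. integral\<^sup>L (M n) (\<lambda>\<omega>. Z n \<omega> ^ r))
               \<longlonglongrightarrow> integral\<^sup>L std_normal_distribution (\<lambda>x. x ^ r))"
proof -
  have ld: "letter_distribution I (p n) R" if "1 \<le> n" for n
    using assms(2,3,7-9) that by unfold_locales auto
  define F where "F n = letter_distribution.mset_gf I (p n)" for n
  define Q where "Q n = letter_distribution.word_gf I (p n)" for n
  define N where "N n \<omega> = num_cycles n (standardize n (\<lambda>j. G n j \<omega>))" for n \<omega>
  \<comment> \<open>The moment generating function of \<open>Z n\<close> at complex arguments: on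
    the imaginary axis it is the characteristic function, and its derivatives at 0 are the
    moments.\<close>
  define \<phi> where "\<phi> n s = (\<integral>\<omega>. exp (s * of_real (Z n \<omega>)) \<partial>M n)" for n and s :: complex
  define \<zeta> where "\<zeta> n l = (real l - ln (real n)) / sqrt (ln (real n))" for n l
  define P where "P n l = measure (M n) (N n -` {l} \<inter> space (M n))" for n l
  have Z_eq: "Z n \<omega> = \<zeta> n (N n \<omega>)" for n \<omega> by (simp add: Z_def K_def N_def \<zeta>_def)
  have N_meas: "N n \<in> measurable (M n) (count_space UNIV)" if "1 \<le> n" for n
  proof -
    interpret prob_space "M n" by (rule assms(4)[OF that])
    show ?thesis unfolding N_def
      by (rule measurable_num_cycles_standardize) (use assms(5)[OF that] in \<open>auto simp: indep_vars_def\<close>)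
  qed
  have Z_meas: "Z n \<in> borel_measurable (M n)" if "1 \<le> n" for n
    unfolding Z_eq by (rule measurable_compose[OF N_meas[OF that]]) simp
  have expect: "(\<integral>\<omega>. h (Z n \<omega>) \<partial>M n) = (\<Sum>l\<le>n. P n l *\<^sub>R h (\<zeta> n l))"
    if "1 \<le> n" for n and h :: "real \<Rightarrow> complex"
    unfolding Z_eq P_def
    by (rule expectation_bounded_nat[OF assms(4)[OF that] N_meas[OF that]])
       (simp add: N_def num_cycles_standardize_le)
  have \<phi>_sum: "\<phi> n = (\<lambda>s. \<Sum>l\<le>n. of_real (P n l) * exp (s * of_real (\<zeta> n l)))" if "1 \<le> n" for n
    proof
    fix s show "\<phi> n s = (\<Sum>l\<le>n. of_real (P n l) * exp (s * of_real (\<zeta> n l)))"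
      using expect[OF that, of "\<lambda>x. exp (s * of_real x)"] by (simp add: \<phi>_def scaleR_conv_of_real)
  qed
  \<comment> \<open>From \<open>n = 2\<close> on the denominator \<open>sqrt (ln n)\<close> is
    nonzero; limits see only such \<open>n\<close>.\<close>
  have \<phi>_eq: "\<phi> n s = exp (- s * of_real (sqrt (ln (real n)))) * F n n (s / of_real (sqrt (ln (real n))))"
    if n: "2 \<le> n" for n s
  proof -
    interpret prob_space "M n" by (rule assms(4)) (use n in simp)
    have n1: "1 \<le> n" using n by simp
    let ?a = "complex_of_real (sqrt (ln (real n)))"
    have "ln (real n) > 0" using n by simp
    then have a: "?a \<noteq> 0" "complex_of_real (ln (real n)) = ?a * ?a" by (auto simp flip: of_real_mult)
    have "exp (s * of_real (Z n \<omega>)) = exp (- s * ?a) * exp (of_nat (N n \<omega>) * (s / ?a))" for \<omega>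
      unfolding Z_eq \<zeta>_def using a by (simp add: field_simps flip: exp_add)
    then have "\<phi> n s = exp (- s * ?a) * (\<integral>\<omega>. exp (of_nat (N n \<omega>) * (s / ?a)) \<partial>M n)"
      unfolding \<phi>_def by simp
    also have "(\<integral>\<omega>. exp (of_nat (N n \<omega>) * (s / ?a)) \<partial>M n) = F n n (s / ?a)"
      unfolding N_def F_def
      by (rule expectation_exp_num_cycles[OF assms(4)[OF n1] assms(5)[OF n1] n1 assms(6)[OF n1] ld[OF n1]])
    finally show ?thesis .
  qed
  have lim: "uniform_limit (cball 0 \<rho>) \<phi> (\<lambda>s. exp (s\<^sup>2 / 2)) sequentially" for \<rho>
  proof -
    have "uniform_limit (cball 0 \<rho>)
       (\<lambda>n s. exp (- s * of_real (sqrt (ln (real n)))) * F n n (s / of_real (sqrt (ln (real n)))))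
       (\<lambda>s. exp (s\<^sup>2 / 2)) sequentially"
    proof (rule perturbed_ewens_limit[where r = "sqrt R" and F = F and Q = Q])
      show "0 < sqrt R" "sqrt R < 1" using assms(7,8) by auto
      show "F n 0 z = 1" if "1 \<le> n" for n z
        unfolding F_def by (rule letter_distribution.mset_gf_0[OF ld[OF that]])
      show "of_nat m * F n m z = (\<Sum>k=1..m. Q n k z * F n (m - k) z)" if "1 \<le> n" for n m z
        unfolding F_def Q_def by (rule letter_distribution.mset_gf_rec[OF ld[OF that]])
      show "norm (Q n k z - exp z) \<le> norm z * (real k)\<^sup>2 * (sqrt R * exp (norm z)) ^ k"
        if "1 \<le> n" "0 < k" for n k z
        unfolding Q_def by (rule letter_distribution.word_gf_bound[OF ld[OF that(1)] that(2)])
    qed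
    then show ?thesis
      by (rule uniform_limit_cong[THEN iffD1, rotated 2])
         (use \<phi>_eq in \<open>auto intro!: eventually_mono[OF eventually_ge_at_top[of 2]]\<close>)
  qed
  \<comment> \<open>The index is shifted because the hypotheses start at \<open>n = 1\<close>, while
    the continuity theorem asks for a probability distribution at every index.\<close>
  have "weak_conv_m (\<lambda>n. distr (M (Suc n)) borel (Z (Suc n))) std_normal_distribution"
  proof (rule levy_continuity[OF _ real_dist_normal_dist])
    fix n
    interpret prob_space "M (Suc n)" by (rule assms(4)) simp
    show "real_distribution (distr (M (Suc n)) borel (Z (Suc n)))"
      by (rule real_distribution_distr) (use Z_meas in simp)
  next
    fix t
    have "(\<lambda>n. \<phi> n (\<i> * of_real t)) \<longlonglongrightarrow> exp ((\<i> * of_real t)\<^sup>2 / 2)"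
      by (rule tendsto_uniform_limitI[OF lim[of "\<bar>t\<bar>"]]) (simp add: norm_mult)
    then have "(\<lambda>n. \<phi> (Suc n) (\<i> * of_real t)) \<longlonglongrightarrow> exp ((\<i> * of_real t)\<^sup>2 / 2)"
      by (rule LIMSEQ_Suc)
    moreover have "char (distr (M (Suc n)) borel (Z (Suc n))) t = \<phi> (Suc n) (\<i> * of_real t)" for n
      unfolding char_def \<phi>_def using Z_meas[of "Suc n"]
      by (subst integral_distr) (auto simp: mult_ac)
    moreover have "exp ((\<i> * of_real t)\<^sup>2 / 2) = char std_normal_distribution t"
      by (simp add: char_std_normal_distribution power_mult_distrib flip: exp_of_real)
    ultimately show "(\<lambda>n. char (distr (M (Suc n)) borel (Z (Suc n))) t) \<longlonglongrightarrow> char std_normal_distribution t"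
      by simp
  qed
  then have "weak_conv_m (\<lambda>n. distr (M n) borel (Z n)) std_normal_distribution"
    unfolding weak_conv_m_def weak_conv_def by (auto intro: LIMSEQ_imp_Suc)
  moreover have "(\<lambda>n. \<integral>\<omega>. Z n \<omega> ^ r \<partial>M n) \<longlonglongrightarrow> (\<integral>x. x ^ r \<partial>std_normal_distribution)" for r
  proof -
    have moment: "(deriv ^^ r) (\<phi> n) 0 = of_real (\<integral>\<omega>. Z n \<omega> ^ r \<partial>M n)" if n: "1 \<le> n" for n
    proof -
      have "(deriv ^^ r) (\<phi> n) 0 = (\<Sum>l\<le>n. P n l *\<^sub>R (of_real (\<zeta> n l) :: complex) ^ r)"
        unfolding \<phi>_sum[OF n] higher_deriv_exp_sum by (simp add: scaleR_conv_of_real)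
      also have "\<dots> = (\<integral>\<omega>. of_real (Z n \<omega>) ^ r \<partial>M n)"
        using expect[OF n, of "\<lambda>x. of_real x ^ r"] by simp
      finally show ?thesis by (simp flip: of_real_power)
    qed
    \<comment> \<open>Locally uniform convergence of holomorphic functions carries over to all
      derivatives.\<close>
    have "(\<lambda>n. (deriv ^^ r) (\<phi> n) 0) \<longlonglongrightarrow> (deriv ^^ r) (\<lambda>s. exp (s\<^sup>2 / 2)) 0"
    proof (rule higher_deriv_complex_uniform_limit)
      show "uniform_limit (ball 0 1) \<phi> (\<lambda>s. exp (s\<^sup>2 / 2)) sequentially"
        by (rule uniform_limit_on_subset[OF lim[of 1]]) auto
      show "\<forall>\<^sub>F n in sequentially. \<phi> n holomorphic_on ball 0 1"
        using eventually_ge_at_top[of 1]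
        by eventually_elim (simp add: \<phi>_sum, intro holomorphic_intros)
    qed auto
    then have "(\<lambda>n. (deriv ^^ r) (\<phi> n) 0) \<longlonglongrightarrow> of_real (\<integral>x. x ^ r \<partial>std_normal_distribution)"
      by (simp only: std_normal_moment_eq_higher_deriv)
    then have "(\<lambda>n. complex_of_real (\<integral>\<omega>. Z n \<omega> ^ r \<partial>M n)) \<longlonglongrightarrow> of_real (\<integral>x. x ^ r \<partial>std_normal_distribution)"
      by (rule Lim_transform_eventually)
         (use moment in \<open>auto intro!: eventually_mono[OF eventually_ge_at_top[of 1]]\<close>)
    then show ?thesis by (simp only: tendsto_of_real_iff)
  qed
  ultimately show ?thesis by blast
qed

end
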